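(* Let $W=(W_t)_{t\ge 0}$ be a standard linear Brownian motion started at $0$ and, for every $\kappa>0$, let $B^\kappa_t := e^{iW_{\kappa t}}$, $t\in[0,1]$ (the same $W$ for all $\kappa$). Let $\{f^\kappa_t\}_{t\in[0,1]}$ be the radial Loewner chain on $\mathbb{D}$ driven by $\zeta_t = B^\kappa_t$. Then, almost surely, as $\kappa\to\infty$, the Loewner chain $\{f^\kappa_t\}_{t\in[0,1]}$ converges to $\{z\mapsto e^{-t}z\}_{t\in[0,1]}$ with respect to the uniform Carathéodory topology.
   Context: $\mathbb{D}=\{z\in\mathbb{C}:|z|<1\}$ and $S^1=\{\zeta\in\mathbb{C}:|\zeta|=1\}$. Radial Loewner chain: given a continuous driving function $t\mapsto\zeta_t\in S^1$ on $[0,1]$, for each $z\in\mathbb{D}$ solve $$\partial_t g_t(z) = -g_t(z)\,\frac{g_t(z)+\zeta_t}{g_t(z)-\zeta_t},\qquad g_0(z)=z.$$ Let $D_t\subset\mathbb{D}$ be the set of $z$ for which the solution is well-defined up to time $t$ with $g_t(z)\in\mathbb{D}$. Then $g_t$ is a conformal map of the simply connected domain $D_t$ onto $\mathbb{D}$, and $f_t:=g_t^{-1}:\mathbb{D}\to D_t$ satisfies $f_t(0)=0$, $f_t'(0)=e^{-t}$. The family $\{f_t\}_{t\in[0,1]}$ is the radial Loewner chain driven by $\{\zeta_t\}$. When $\zeta_t=B^\kappa_t$ this is the Loewner chain of radial $\mathrm{SLE}_\kappa$ in $\mathbb{D}$ targeted at $0$, run on the time interval $[0,1]$. Uniform Carathéodory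 topology: writing $f(z,t)=f_t(z)$, it is the topology of uniform convergence of $f$ on compact subsets of $\mathbb{D}\times[0,1]$. *)

theory Defs
  imports "HOL-Probability.Probability"
begin

text \<open>
  Standard linear Brownian motion started at 0, on the time set \<open>[0, \<infinity>)\<close>; only the values
  \<open>W t\<close> with \<open>t \<ge> 0\<close> are constrained.
\<close>

locale standard_brownian_motion = prob_space M for M :: "'a measure" +
  fixes W :: "real \<Rightarrow> 'a \<Rightarrow> real"
  assumes random_variable: "\<And>t. 0 \<le> t \<Longrightarrow> W t \<in> borel_measurable M"
    and start: "AE \<omega> in M. W 0 \<omega> = 0"
    and independent_increments:
      "\<And>(\<tau> :: nat \<Rightarrow> real) n. 0 \<le> \<tau> 0 \<Longrightarrow> (\<And>i. i < n \<Longrightarrow> \<tau> i < \<tau> (Suc i)) \<Longrightarrow>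
        indep_vars (\<lambda>_. borel) (\<lambda>i \<omega>. W (\<tau> (Suc i)) \<omega> - W (\<tau> i) \<omega>) {..<n}"
    and gaussian_increments:
      "\<And>s t. 0 \<le> s \<Longrightarrow> s < t \<Longrightarrow>
        distributed M lborel (\<lambda>\<omega>. W t \<omega> - W s \<omega>) (normal_density 0 (sqrt (t - s)))"
    and continuous_paths: "AE \<omega> in M. continuous_on {0..} (\<lambda>t. W t \<omega>)"

text \<open>
  \<open>radial_loewner_solution \<zeta> t z \<gamma>\<close>: the curve \<open>s \<mapsto> \<gamma> s\<close> solves the radial Loewner equation
  driven by \<open>\<zeta>\<close> on \<open>[0, t]\<close> from \<open>z\<close> without leaving the open unit disc (derivatives at the
  endpoints are one-sided). As \<open>\<bar>\<zeta> s\<bar> = 1\<close>, the denominator does not vanish along such a curve.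
\<close>

definition radial_loewner_solution ::
    "(real \<Rightarrow> complex) \<Rightarrow> real \<Rightarrow> complex \<Rightarrow> (real \<Rightarrow> complex) \<Rightarrow> bool" where
  "radial_loewner_solution \<zeta> t z \<gamma> \<longleftrightarrow>
     \<gamma> 0 = z \<and>
     (\<forall>s\<in>{0..t}. \<gamma> s \<in> ball 0 1 \<and>
        (\<gamma> has_vector_derivative - \<gamma> s * ((\<gamma> s + \<zeta> s) / (\<gamma> s - \<zeta> s))) (at s within {0..t}))"

definition radial_loewner_domain :: "(real \<Rightarrow> complex) \<Rightarrow> real \<Rightarrow> complex set" where
  "radial_loewner_domain \<zeta> t = {z \<in> ball 0 1. \<exists>\<gamma>. radial_loewner_solution \<zeta> t z \<gamma>}"

text \<open>
  The map \<open>g\<^sub>t\<close>, meaningful on \<open>radial_loewner_domain \<zeta> t\<close>. The curves \<open>\<gamma>\<close> are determined only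
  on \<open>[0, t]\<close>, so the description singles out the endpoint rather than the curve.
\<close>

definition radial_loewner_map :: "(real \<Rightarrow> complex) \<Rightarrow> real \<Rightarrow> complex \<Rightarrow> complex" where
  "radial_loewner_map \<zeta> t z = (THE w. \<exists>\<gamma>. radial_loewner_solution \<zeta> t z \<gamma> \<and> \<gamma> t = w)"

definition radial_loewner_chain :: "(real \<Rightarrow> complex) \<Rightarrow> real \<Rightarrow> complex \<Rightarrow> complex" where
  "radial_loewner_chain \<zeta> t = the_inv_into (radial_loewner_domain \<zeta> t) (radial_loewner_map \<zeta> t)"

text \<open>
  Convergence of families \<open>(f\<^sub>t)\<close>, \<open>t \<in> [0, 1]\<close>, of functions on the unit disc (time is the first
  argument) in the uniform Caratheodory topology.
\<close>

definition uniform_caratheodory_limit ::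
    "('i \<Rightarrow> real \<Rightarrow> complex \<Rightarrow> complex) \<Rightarrow> (real \<Rightarrow> complex \<Rightarrow> complex) \<Rightarrow> 'i filter \<Rightarrow> bool" where
  "uniform_caratheodory_limit f l F \<longleftrightarrow>
     (\<forall>K. compact K \<and> K \<subseteq> ball 0 1 \<times> {0..1} \<longrightarrow>
        uniform_limit K (\<lambda>i (z, t). f i t z) (\<lambda>(z, t). l t z) F)"

end

theory Submission
  imports Defs
begin

text \<open>Along a solution \<open>\<gamma>\<close> with \<open>\<gamma> t = w\<close> one has
  \<open>(exp (- s) \<gamma>)' = 2 exp (- s) (\<Sum>n\<ge>1. \<gamma> ^ Suc n * \<zeta> ^ -n)\<close>, so \<open>f\<^sub>t(w) = \<gamma> 0\<close> is close to
  \<open>exp (- t) w\<close> as soon as the primitives of \<open>\<zeta> ^ -n\<close>, \<open>n \<ge> 1\<close>, are uniformly small.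
  For \<open>\<zeta> s = exp (\<i> W (\<kappa> s))\<close> these primitives are rescaled time means of \<open>exp (- \<i> n W)\<close>, and
  Brownian motion equidistributes modulo \<open>2\<pi>\<close>: the second moment of the integral over \<open>[0, T]\<close> is
  \<open>O(T)\<close> because \<open>E exp (\<i> a (W t - W s)) = exp (- a\<^sup>2 \<bar>t - s\<bar> / 2)\<close>, so the means along \<open>T = k\<^sup>2\<close> are
  almost surely square summable, and in between they vary little.\<close>

section \<open>Solutions of the radial Loewner equation\<close>

text \<open>Each Picard step integrates the previous error over \<open>{s..b}\<close> and thereby
  gains a factorial, so the iterates converge on the whole interval however large
  \<open>L * (b - a)\<close> is. The set \<open>S\<close> confines the curves to a region where the
  operator is Lipschitz; its closedness passes this confinement to the limit. The integral runs from
  \<open>s\<close> to \<open>b\<close> because the Loewner equation is solved backwards from its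
  terminal value.\<close>

lemma volterra_fixed_point:
  fixes \<Phi> :: "(real \<Rightarrow> 'a::banach) \<Rightarrow> real \<Rightarrow> 'a" and S :: "'a set" and a b :: real
  defines "X \<equiv> {f. continuous_on {a..b} f \<and> f ` {a..b} \<subseteq> S}"
  assumes S: "closed S" and L: "0 \<le> L" and ab: "a \<le> b" and h: "h \<in> X"
    and maps: "\<And>f. f \<in> X \<Longrightarrow> \<Phi> f \<in> X"
    and lip: "\<And>f g s. \<lbrakk>f \<in> X; g \<in> X; s \<in> {a..b}\<rbrakk> \<Longrightarrow>
      norm (\<Phi> f s - \<Phi> g s) \<le> L * integral {s..b} (\<lambda>u. norm (f u - g u))"
  shows "\<exists>f\<in>X. \<forall>s\<in>{a..b}. \<Phi> f s = f s"
proof -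
  define x where "x n = (\<Phi> ^^ n) h" for n
  have xX: "x n \<in> X" for n
    by (induction n) (auto simp: x_def h maps)
  have x_Suc: "x (Suc n) = \<Phi> (x n)" for n
    by (simp add: x_def)
  have cont: "continuous_on {a..b} f" if "f \<in> X" for f
    using that by (simp add: X_def)
  have "compact ((\<lambda>s. norm (x 1 s - x 0 s)) ` {a..b})"
    by (intro compact_continuous_image continuous_intros cont xX compact_Icc)
  then have "bounded ((\<lambda>s. norm (x 1 s - x 0 s)) ` {a..b})"
    by (rule compact_imp_bounded)
  then obtain D where "\<And>s. s \<in> {a..b} \<Longrightarrow> norm (norm (x 1 s - x 0 s)) \<le> D"
    unfolding bounded_iff by blast
  then have D: "norm (x 1 s - x 0 s) \<le> D" if "s \<in> {a..b}" for s
    using that by simp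
  have step: "norm (x (Suc n) s - x n s) \<le> D * ((L * (b - s)) ^ n / fact n)" if "s \<in> {a..b}" for n s
    using that
  proof (induction n arbitrary: s)
    case 0
    then show ?case using D by simp
  next
    case (Suc n)
    \<comment> \<open>Integrating the power \<open>(b - u) ^ n\<close> produces the next power
      together with the factor that turns \<open>fact n\<close> into
      \<open>fact (Suc n)\<close>.\<close>
    have I: "((\<lambda>u. D * (L ^ n * (b - u) ^ n / fact n)) has_integral
        D * (L ^ n * (b - s) ^ Suc n / fact (Suc n))) {s..b}"
    proof -
      have "((\<lambda>u. D * (L ^ n * (b - u) ^ n / fact n)) has_integral
         (- D * (L ^ n * (b - b) ^ Suc n / fact (Suc n))) - (- D * (L ^ n * (b - s) ^ Suc n / fact (Suc n)))) {s..b}"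
        using Suc.prems
        by (intro fundamental_theorem_of_calculus)
          (auto intro!: derivative_eq_intros simp: has_real_derivative_iff_has_vector_derivative [symmetric]
            divide_simps simp del: power_Suc fact_Suc, auto simp: field_simps)
      then show ?thesis by simp
    qed
    have "norm (x (Suc (Suc n)) s - x (Suc n) s)
        \<le> L * integral {s..b} (\<lambda>u. norm (x (Suc n) u - x n u))"
      unfolding x_Suc[of "Suc n"] x_Suc[of n] using xX[of "Suc n"] xX[of n] Suc.prems
      by (metis lip x_Suc)
    also have "\<dots> \<le> L * (D * (L ^ n * (b - s) ^ Suc n / fact (Suc n)))"
    proof (rule mult_left_mono[OF _ L])
      show "integral {s..b} (\<lambda>u. norm (x (Suc n) u - x n u)) \<le> D * (L ^ n * (b - s) ^ Suc n / fact (Suc n))"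
      proof (rule order_trans[OF integral_le[where g = "\<lambda>u. D * (L ^ n * (b - u) ^ n / fact n)"]])
        have "continuous_on {s..b} (x k)" for k
          using cont[OF xX] by (rule continuous_on_subset) (use Suc.prems in auto)
        then show "(\<lambda>u. norm (x (Suc n) u - x n u)) integrable_on {s..b}"
          by (intro integrable_continuous_interval continuous_intros)
        show "norm (x (Suc n) u - x n u) \<le> D * (L ^ n * (b - u) ^ n / fact n)" if "u \<in> {s..b}" for u
          using Suc.IH[of u] Suc.prems that by (simp add: power_mult_distrib)
      qed (use I in \<open>auto simp: has_integral_iff\<close>)
    qed
    finally show ?case
      by (simp add: power_mult_distrib mult_ac del: fact_Suc)
  qed
  have D0: "0 \<le> D"
    by (rule order_trans[OF norm_ge_zero D[of a]]) (use ab in simp)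
  \<comment> \<open>The bound at \<open>s = a\<close> dominates the others and is a term of an
    exponential series, so the telescoping series of increments converges uniformly by the
    M-test.\<close>
  have "summable (\<lambda>n. D * ((L * (b - a)) ^ n / fact n))"
    using summable_exp[of "L * (b - a)"] by (rule summable_mult[OF back_subst[of summable]]) (auto simp: field_simps)
  moreover have "norm (x (Suc n) s - x n s) \<le> D * ((L * (b - a)) ^ n / fact n)" if "s \<in> {a..b}" for n s
    using that L D0
    by (intro order_trans[OF step[OF that]] mult_left_mono divide_right_mono power_mono) auto
  ultimately have "uniform_limit {a..b} (\<lambda>n s. \<Sum>i<n. x (Suc i) s - x i s)
      (\<lambda>s. suminf (\<lambda>i. x (Suc i) s - x i s)) sequentially"
    by (intro Weierstrass_m_test)
  then have "uniform_limit {a..b} (\<lambda>n s. x 0 s + (\<Sum>i<n. x (Suc i) s - x i s))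
      (\<lambda>s. x 0 s + suminf (\<lambda>i. x (Suc i) s - x i s)) sequentially"
    by (intro uniform_limit_add uniform_limit_const)
  moreover have "x 0 s + (\<Sum>i<n. x (Suc i) s - x i s) = x n s" for n s
    using sum_lessThan_telescope[of "\<lambda>i. x i s" n] by simp
  ultimately obtain f where f: "uniform_limit {a..b} x f sequentially"
    by auto
  have fX: "f \<in> X"
    unfolding X_def
  proof (intro CollectI conjI subsetI)
    show "continuous_on {a..b} f"
      by (rule uniform_limit_theorem[OF _ f]) (auto intro!: always_eventually cont xX)
    fix y assume "y \<in> f ` {a..b}"
    then obtain s where s: "s \<in> {a..b}" "y = f s" by auto
    then have "(\<lambda>n. x n s) \<longlonglongrightarrow> y"
      using tendsto_uniform_limitI[OF f] by blast
    then show "y \<in> S"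
      using S s xX unfolding X_def
      by (metis (no_types, lifting) closed_sequentially image_subset_iff mem_Collect_eq)
  qed
  \<comment> \<open>Both sides are limits of \<open>x (Suc n) s\<close>: uniform convergence sends
    the integral in the Lipschitz bound to 0.\<close>
  have "\<Phi> f s = f s" if s: "s \<in> {a..b}" for s
  proof (rule LIMSEQ_unique)
    show "(\<lambda>n. x (Suc n) s) \<longlonglongrightarrow> f s"
      using tendsto_uniform_limitI[OF f s] by (rule LIMSEQ_Suc)
    have cont': "continuous_on {s..b} (x k)" "continuous_on {s..b} f" for k
      using s by (auto intro!: continuous_on_subset[OF cont[OF xX]] continuous_on_subset[OF cont[OF fX]])
    have "uniform_limit {s..b} x f sequentially"
      using f by (rule uniform_limit_on_subset) (use s in auto)
    then have "uniform_limit {s..b} (\<lambda>n u. norm (x n u - f u)) (\<lambda>u. 0) sequentially"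
      by (auto simp: uniform_limit_iff dist_norm)
    then obtain I J where I: "\<And>n. ((\<lambda>u. norm (x n u - f u)) has_integral I n) {s..b}"
      and J: "((\<lambda>u. 0) has_integral J) {s..b}" "I \<longlonglongrightarrow> (J :: real)"
      by (rule uniform_limit_integral) (auto intro!: continuous_intros cont')
    have "(\<lambda>n. integral {s..b} (\<lambda>u. norm (x n u - f u))) \<longlonglongrightarrow> 0"
      using J has_integral_unique[OF J(1) has_integral_0] integral_unique[OF I] by simp
    then have "(\<lambda>n. L * integral {s..b} (\<lambda>u. norm (x n u - f u))) \<longlonglongrightarrow> 0"
      by (rule tendsto_mult_right_zero)
    then have "(\<lambda>n. x (Suc n) s - \<Phi> f s) \<longlonglongrightarrow> 0"
      by (rule Lim_null_comparison[rotated]) (auto simp: x_Suc intro!: always_eventually lip xX fX s)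
    then show "(\<lambda>n. x (Suc n) s) \<longlonglongrightarrow> \<Phi> f s"
      by (rule LIM_zero_cancel)
  qed
  with fX show ?thesis by blast
qed

section \<open>Elementary properties of the radial vector field\<close>

text \<open>After multiplication by \<open>cnj (y - z)\<close> the sign is that of the difference of
  the squared norms. With \<open>y = \<gamma> s\<close> and \<open>z = \<zeta> s\<close> this says
  that the norm of a solution does not decrease in time, so solving backwards never leaves the disc
  of the terminal value.\<close>

lemma Re_divide_add_diff_nonpos:
  fixes y z :: complex
  assumes "norm y \<le> norm z"
  shows "Re ((y + z) / (y - z)) \<le> 0"
proof -
  have "Re ((y + z) * cnj (y - z)) = (norm y)\<^sup>2 - (norm z)\<^sup>2"
    by (simp add: cmod_power2) (simp add: power2_eq_square algebra_simps)
  also have "\<dots> \<le> 0"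
    using assms by (simp add: power_mono)
  finally show ?thesis
    by (metis complex_div_cnj Re_divide_of_real divide_nonpos_nonneg of_real_power zero_le_power2)
qed

text \<open>The left half-plane is convex and the derivative of \<open>exp\<close> has norm at most
  1 on it, so the mean value inequality applies.\<close>

lemma norm_exp_diff_le:
  fixes u v :: complex
  assumes "Re u \<le> 0" "Re v \<le> 0"
  shows "norm (exp u - exp v) \<le> norm (u - v)"
proof -
  have "norm (exp u - exp v) \<le> 1 * norm (u - v)"
  proof (rule differentiable_bound)
    show "convex {z. Re z \<le> 0}"
      by (rule convex_halfspace_Re_le)
    show "(exp has_derivative (\<lambda>h. h * exp x)) (at x within {z. Re z \<le> 0})" for x
      by (auto intro!: derivative_eq_intros)
    show "onorm (\<lambda>h. h * exp x) \<le> 1" if "x \<in> {z. Re z \<le> 0}" for x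
      using that by (intro onorm_le) (auto simp: norm_mult intro: mult_left_le)
  qed (use assms in auto)
  then show ?thesis by simp
qed

lemma norm_le_norm_diff_unit:
  fixes y z :: complex
  assumes "norm z = 1" "norm y \<le> r"
  shows "1 - r \<le> norm (y - z)"
  using norm_triangle_ineq2[of z y] assms by (simp add: norm_minus_commute)

text \<open>Division with remainder writes the field as
  \<open>- y - 2 * z - 2 * z\<^sup>2 / (y - z)\<close>. Since \<open>y - y'\<close> splits off
  exactly, the difference of two solutions satisfies a scalar linear equation.\<close>

lemma radial_vector_field_diff:
  fixes y y' z :: complex
  assumes "y \<noteq> z" "y' \<noteq> z"
  shows "- y * ((y + z) / (y - z)) - (- y' * ((y' + z) / (y' - z)))
    = (2 * z\<^sup>2 / ((y - z) * (y' - z)) - 1) * (y - y')"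
  using assms by (simp add: divide_simps) (simp add: algebra_simps power2_eq_square)

section \<open>Uniqueness and inversion of the flow\<close>

lemma radial_loewner_solution_continuous_on:
  assumes "radial_loewner_solution \<zeta> t z \<gamma>"
  shows "continuous_on {0..t} \<gamma>"
  unfolding continuous_on_eq_continuous_within
  using assms has_vector_derivative_continuous unfolding radial_loewner_solution_def by blast

text \<open>The difference of the two curves satisfies a linear equation with continuous coefficient
  \<open>a\<close>, so its product with the integrating factor \<open>exp (- A u)\<close> is
  constant. The starting points may differ and the meeting time \<open>s0\<close> is arbitrary:
  \<open>s0 = 0\<close> shows that the start determines the endpoint, \<open>s0 = t\<close> that the
  endpoint determines the start.\<close>

lemma radial_loewner_solution_unique:
  assumes cont: "continuous_on {0..t} \<zeta>" and unit: "\<And>s. s \<in> {0..t} \<Longrightarrow> norm (\<zeta> s) = 1"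
    and sol: "radial_loewner_solution \<zeta> t z \<gamma>" "radial_loewner_solution \<zeta> t z' \<gamma>'"
    and s: "s0 \<in> {0..t}" "\<gamma> s0 = \<gamma>' s0" "s \<in> {0..t}"
  shows "\<gamma> s = \<gamma>' s"
proof -
  have in_ball: "norm (\<gamma> u) < 1" "norm (\<gamma>' u) < 1" if "u \<in> {0..t}" for u
    using sol that by (auto simp: radial_loewner_solution_def)
  have neq: "\<gamma> u \<noteq> \<zeta> u" "\<gamma>' u \<noteq> \<zeta> u" if "u \<in> {0..t}" for u
    using in_ball[OF that] unit[OF that] by auto
  have deriv: "(\<gamma> has_vector_derivative - \<gamma> u * ((\<gamma> u + \<zeta> u) / (\<gamma> u - \<zeta> u))) (at u within {0..t})"
    "(\<gamma>' has_vector_derivative - \<gamma>' u * ((\<gamma>' u + \<zeta> u) / (\<gamma>' u - \<zeta> u))) (at u within {0..t})"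
    if "u \<in> {0..t}" for u
    using sol that by (auto simp: radial_loewner_solution_def)
  define a where "a u = 2 * (\<zeta> u)\<^sup>2 / ((\<gamma> u - \<zeta> u) * (\<gamma>' u - \<zeta> u)) - 1" for u
  define A where "A u = integral {0..u} a" for u
  have "continuous_on {0..t} \<gamma>" "continuous_on {0..t} \<gamma>'"
    using sol by (auto intro: radial_loewner_solution_continuous_on)
  then have "continuous_on {0..t} a"
    unfolding a_def by (intro continuous_intros cont) (use neq in auto)
  then have A: "(A has_vector_derivative a u) (at u within {0..t})" if "u \<in> {0..t}" for u
    unfolding A_def using that by (rule integral_has_vector_derivative)
  define d where "d u = (\<gamma> u - \<gamma>' u) * exp (- A u)" for u
  have "(d has_vector_derivative 0) (at u within {0..t})" if u: "u \<in> {0..t}" for u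
  proof -
    have "((\<lambda>u. \<gamma> u - \<gamma>' u) has_vector_derivative a u * (\<gamma> u - \<gamma>' u)) (at u within {0..t})"
      using has_vector_derivative_diff[OF deriv[OF u]] radial_vector_field_diff[OF neq[OF u]]
      by (simp add: a_def)
    moreover have "((\<lambda>u. exp (- A u)) has_vector_derivative (- a u) * exp (- A u)) (at u within {0..t})"
      using field_vector_diff_chain_within[OF has_vector_derivative_minus[OF A[OF u]], of exp "exp (- A u)"]
      by (simp add: o_def DERIV_exp has_field_derivative_at_within)
    ultimately show ?thesis
      unfolding d_def by (rule has_vector_derivative_eq_rhs[OF has_vector_derivative_mult]) (simp add: algebra_simps)
  qed
  then obtain c where "\<And>u. u \<in> {0..t} \<Longrightarrow> d u = c"
    using has_derivative_zero_constant[of "{0..t}" d] by (auto simp: has_vector_derivative_def)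
  then have "d s = d s0"
    using s by simp
  then show ?thesis
    using s by (simp add: d_def)
qed

text \<open>Uniqueness from time 0 makes the definite description in
  \<open>radial_loewner_map\<close> denote \<open>\<gamma> t\<close>; uniqueness from time
  \<open>t\<close> makes that map injective on its domain, so \<open>the_inv_into\<close> recovers
  the starting point. Evaluating the chain at \<open>w\<close> thus amounts to following one curve
  that ends at \<open>w\<close> back to time 0.\<close>

lemma radial_loewner_chain_eqI:
  assumes cont: "continuous_on {0..t} \<zeta>" and unit: "\<And>s. s \<in> {0..t} \<Longrightarrow> norm (\<zeta> s) = 1"
    and t: "0 \<le> t" and sol: "radial_loewner_solution \<zeta> t z \<gamma>"
  shows "radial_loewner_chain \<zeta> t (\<gamma> t) = z"
proof -
  note uniq = radial_loewner_solution_unique[OF cont unit]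
  have start: "\<gamma> 0 = z" if "radial_loewner_solution \<zeta> t z \<gamma>" for z \<gamma>
    using that by (simp add: radial_loewner_solution_def)
  have map: "radial_loewner_map \<zeta> t z = \<gamma> t" if "radial_loewner_solution \<zeta> t z \<gamma>" for z \<gamma>
    unfolding radial_loewner_map_def
  proof (rule the_equality)
    fix w assume "\<exists>\<gamma>'. radial_loewner_solution \<zeta> t z \<gamma>' \<and> \<gamma>' t = w"
    then obtain \<gamma>' where \<gamma>': "radial_loewner_solution \<zeta> t z \<gamma>'" "\<gamma>' t = w"
      by blast
    have "\<gamma>' t = \<gamma> t"
      by (rule uniq[OF _ \<gamma>'(1) that, of 0]) (use t start[OF \<gamma>'(1)] start[OF that] in auto)
    then show "w = \<gamma> t"
      using \<gamma>' by simp
  qed (use that in blast)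
  have "inj_on (radial_loewner_map \<zeta> t) (radial_loewner_domain \<zeta> t)"
  proof (rule inj_onI)
    fix x y assume xy: "x \<in> radial_loewner_domain \<zeta> t" "y \<in> radial_loewner_domain \<zeta> t"
      "radial_loewner_map \<zeta> t x = radial_loewner_map \<zeta> t y"
    then obtain \<gamma>\<^sub>x \<gamma>\<^sub>y
      where x: "radial_loewner_solution \<zeta> t x \<gamma>\<^sub>x" and y: "radial_loewner_solution \<zeta> t y \<gamma>\<^sub>y"
      by (auto simp: radial_loewner_domain_def)
    have "\<gamma>\<^sub>x 0 = \<gamma>\<^sub>y 0"
      by (rule uniq[OF _ x y, of t]) (use t xy(3) map[OF x] map[OF y] in auto)
    then show "x = y"
      using start[OF x] start[OF y] by simp
  qed
  moreover have "z \<in> radial_loewner_domain \<zeta> t"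
    using sol t by (auto simp: radial_loewner_domain_def radial_loewner_solution_def)
  ultimately show ?thesis
    unfolding radial_loewner_chain_def using map[OF sol] by (intro the_inv_into_f_eq)
qed

text \<open>The equation is solved backwards from its terminal value in the form
  \<open>\<gamma> s = w * exp (\<integral>\<^sub>s\<^sup>t p)\<close>: since \<open>Re p \<le> 0\<close>, Picard iteration preserves the disc of radius \<open>\<bar>w\<bar>\<close>.\<close>

lemma radial_loewner_solution_exists:
  assumes cont: "continuous_on {0..t} \<zeta>" and unit: "\<And>s. s \<in> {0..t} \<Longrightarrow> norm (\<zeta> s) = 1"
    and t: "0 \<le> t" and w: "norm w < 1"
  obtains \<gamma> where "radial_loewner_solution \<zeta> t (\<gamma> 0) \<gamma>" "\<gamma> t = w"
    "\<And>s. s \<in> {0..t} \<Longrightarrow> norm (\<gamma> s) \<le> norm w"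
proof -
  define X where "X = {f :: real \<Rightarrow> complex. continuous_on {0..t} f \<and> f ` {0..t} \<subseteq> cball 0 (norm w)}"
  define p where "p f u = (f u + \<zeta> u) / (f u - \<zeta> u)" for f u
  define \<Phi> where "\<Phi> f s = w * exp (integral {s..t} (p f))" for f s
  have X: "norm (f s) \<le> norm w" if "f \<in> X" "s \<in> {0..t}" for f s
    using that by (force simp: X_def)
  have dist: "1 - norm w \<le> norm (f s - \<zeta> s)" if "f \<in> X" "s \<in> {0..t}" for f s
    using X[OF that] unit[OF that(2)] by (intro norm_le_norm_diff_unit)
  have neq: "f s \<noteq> \<zeta> s" if "f \<in> X" "s \<in> {0..t}" for f s
    using dist[OF that] w by auto
  have cont_p: "continuous_on {0..t} (p f)" if "f \<in> X" for f
    unfolding p_def using that neq[OF that] by (intro continuous_intros cont) (auto simp: X_def)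
  have int_p: "p f integrable_on {s..t}" if "f \<in> X" "s \<in> {0..t}" for f s
    using continuous_on_subset[OF cont_p[OF that(1)]] that(2) by (intro integrable_continuous_interval) auto
  have Re_p: "Re (integral {s..t} (p f)) \<le> 0" if "f \<in> X" "s \<in> {0..t}" for f s
  proof -
    have "Re (integral {s..t} (p f)) = integral {s..t} (\<lambda>u. Re (p f u))"
      using integral_linear[OF int_p[OF that] bounded_linear_Re] by (simp add: o_def)
    also have "\<dots> \<le> integral {s..t} (\<lambda>u. 0)"
    proof (rule integral_le)
      show "(\<lambda>u. Re (p f u)) integrable_on {s..t}"
        using integrable_linear[OF int_p[OF that] bounded_linear_Re] by (simp add: o_def)
      show "Re (p f u) \<le> 0" if "u \<in> {s..t}" for u
        unfolding p_def using X[OF \<open>f \<in> X\<close>, of u] unit[of u] w \<open>s \<in> {0..t}\<close> that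
        by (intro Re_divide_add_diff_nonpos) auto
    qed auto
    finally show ?thesis by simp
  qed
  have deriv: "(\<Phi> f has_vector_derivative - \<Phi> f s * p f s) (at s within {0..t})"
    if "f \<in> X" "s \<in> {0..t}" for f s
  proof -
    have "((\<lambda>s. integral {s..t} (p f)) has_vector_derivative - p f s) (at s within {0..t})"
      using cont_p[OF that(1)] that(2) by (rule integral_has_vector_derivative')
    then have "((\<lambda>s. w * exp (integral {s..t} (p f))) has_vector_derivative
        w * (- p f s * exp (integral {s..t} (p f)))) (at s within {0..t})"
      using field_vector_diff_chain_within[OF _ has_field_derivative_at_within[OF DERIV_exp]]
      unfolding o_def by (intro has_vector_derivative_mult_right) blast
    then show ?thesis
      by (simp add: \<Phi>_def [abs_def] mult_ac)
  qed
  \<comment> \<open>By \<open>deriv\<close>, a fixed point satisfies \<open>f' = - f * p f\<close>,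
    which is the Loewner equation, and the value \<open>f t = w\<close> is built into
    \<open>\<Phi>\<close>.\<close>
  have "\<exists>f\<in>X. \<forall>s\<in>{0..t}. \<Phi> f s = f s"
    unfolding X_def
  proof (rule volterra_fixed_point[where L = "2 / (1 - norm w)\<^sup>2" and h = "\<lambda>_. w"], fold X_def)
    show "(\<lambda>_. w) \<in> X"
      by (auto simp: X_def)
    show "\<Phi> f \<in> X" if "f \<in> X" for f
    proof -
      have "continuous_on {0..t} (\<Phi> f)"
        using deriv[OF that] has_vector_derivative_continuous
        unfolding continuous_on_eq_continuous_within by blast
      moreover have "norm (\<Phi> f s) \<le> norm w" if "s \<in> {0..t}" for s
        unfolding \<Phi>_def norm_mult using Re_p[OF \<open>f \<in> X\<close> that] by (intro mult_left_le) auto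
      ultimately show ?thesis
        by (auto simp: X_def)
    qed
    fix f g s assume fg: "f \<in> X" "g \<in> X" and s: "s \<in> {0..t}"
    define L where "L = 2 / (1 - norm w)\<^sup>2"
    have p_diff: "norm (p f u - p g u) \<le> L * norm (f u - g u)" if u: "u \<in> {0..t}" for u
    proof -
      \<comment> \<open>Here \<open>(y + \<zeta>) / (y - \<zeta>) = 1 + 2 * \<zeta> / (y -
        \<zeta>)\<close>. The constant \<open>L\<close> comes from the two denominators, each at
        least \<open>1 - norm w\<close> for curves in \<open>X\<close>.\<close>
      have "p f u - p g u = - (2 * \<zeta> u * (f u - g u) / ((f u - \<zeta> u) * (g u - \<zeta> u)))"
        using neq[OF fg(1) u] neq[OF fg(2) u] unfolding p_def
        by (simp add: divide_simps) (simp add: algebra_simps)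
      then have "norm (p f u - p g u) = 2 * norm (f u - g u) / (norm (f u - \<zeta> u) * norm (g u - \<zeta> u))"
        using unit[OF u] by (simp add: norm_mult norm_divide)
      also have "\<dots> \<le> 2 * norm (f u - g u) / ((1 - norm w) * (1 - norm w))"
        using dist[OF fg(1) u] dist[OF fg(2) u] w
        by (intro divide_left_mono mult_mono mult_pos_pos) (auto simp: neq[OF _ u] fg)
      finally show ?thesis
        by (simp add: L_def power2_eq_square)
    qed
    have "norm (\<Phi> f s - \<Phi> g s) = norm w * norm (exp (integral {s..t} (p f)) - exp (integral {s..t} (p g)))"
      by (simp add: \<Phi>_def norm_mult flip: right_diff_distrib)
    also have "\<dots> \<le> norm (exp (integral {s..t} (p f)) - exp (integral {s..t} (p g)))"
      using w by (intro mult_left_le_one_le) auto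
    also have "\<dots> \<le> norm (integral {s..t} (p f) - integral {s..t} (p g))"
      by (intro norm_exp_diff_le Re_p fg s)
    also have "\<dots> = norm (integral {s..t} (\<lambda>u. p f u - p g u))"
      by (intro arg_cong[where f = norm] Henstock_Kurzweil_Integration.integral_diff[symmetric] int_p fg s)
    also have "\<dots> \<le> integral {s..t} (\<lambda>u. L * norm (f u - g u))"
    proof (rule integral_norm_bound_integral)
      show "(\<lambda>u. p f u - p g u) integrable_on {s..t}"
        by (intro integrable_diff int_p fg s)
      have "continuous_on {s..t} f" "continuous_on {s..t} g"
        using fg s continuous_on_subset[of "{0..t}" _ "{s..t}"] by (auto simp: X_def)
      then show "(\<lambda>u. L * norm (f u - g u)) integrable_on {s..t}"
        by (intro integrable_continuous_interval continuous_intros)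
    qed (use p_diff s in auto)
    finally show "norm (\<Phi> f s - \<Phi> g s) \<le> 2 / (1 - norm w)\<^sup>2 * integral {s..t} (\<lambda>u. norm (f u - g u))"
      by (simp add: L_def)
  qed (use t in auto)
  then obtain f where f: "f \<in> X" "\<And>s. s \<in> {0..t} \<Longrightarrow> \<Phi> f s = f s"
    by blast
  show thesis
  proof
    show "f t = w"
      using f(2)[of t] t by (simp add: \<Phi>_def)
    show norm_f: "norm (f s) \<le> norm w" if "s \<in> {0..t}" for s
      using X[OF f(1) that] .
    show "radial_loewner_solution \<zeta> t (f 0) f"
      unfolding radial_loewner_solution_def
    proof (intro conjI ballI)
      fix s assume s: "s \<in> {0..t}"
      show "f s \<in> ball 0 1"
        using norm_f[OF s] w by simp
      have "(f has_vector_derivative - \<Phi> f s * p f s) (at s within {0..t})"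
        by (rule has_vector_derivative_transform[OF s _ deriv[OF f(1) s]]) (simp add: f)
      then show "(f has_vector_derivative - f s * ((f s + \<zeta> s) / (f s - \<zeta> s))) (at s within {0..t})"
        using f(2)[OF s] by (simp add: p_def)
    qed simp
  qed
qed

section \<open>Stability under averaging of the driving function\<close>

text \<open>For \<open>x = \<gamma> s / \<zeta> s\<close> the finite sum collects the powers of
  \<open>\<zeta>\<close> whose primitives are controlled, and the exact remainder is small because
  \<open>norm x \<le> r < 1\<close>. Truncation leaves only finitely many averages to
  handle.\<close>

lemma geometric_split:
  fixes x :: "'a::field"
  assumes "x \<noteq> 1"
  shows "x / (1 - x) = (\<Sum>n=1..N. x ^ n) + x ^ Suc N / (1 - x)"
proof (induction N)
  case (Suc N)
  have "x ^ Suc N / (1 - x) = x ^ Suc N + x ^ Suc (Suc N) / (1 - x)"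
    using assms by (simp add: divide_simps) (simp add: algebra_simps)
  then show ?case
    using Suc by (simp add: add.assoc)
qed simp

lemma norm_diff_le_vector_derivative_bound:
  fixes f :: "real \<Rightarrow> 'a::real_normed_vector"
  assumes "a \<le> b"
    and "\<And>s. s \<in> {a..b} \<Longrightarrow> (f has_vector_derivative f' s) (at s within {a..b})"
    and "\<And>s. s \<in> {a..b} \<Longrightarrow> norm (f' s) \<le> B"
  shows "norm (f b - f a) \<le> B * (b - a)"
proof -
  have "norm (f b - f a) \<le> B * norm (b - a)"
  proof (rule differentiable_bound)
    show "onorm (\<lambda>h. h *\<^sub>R f' s) \<le> B" if "s \<in> {a..b}" for s
      using mult_left_mono[OF assms(3)[OF that] abs_ge_zero]
      by (intro onorm_le) (simp add: mult.commute)
  qed (use assms in \<open>auto simp: has_vector_derivative_def\<close>)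
  then show ?thesis
    using assms(1) by simp
qed

text \<open>The auxiliary function \<open>P\<close> performs the integration by parts: only the primitives \<open>A n\<close> of
  \<open>\<zeta> ^ -n\<close>, not \<open>\<zeta> ^ -n\<close> itself, enter its derivative.\<close>

lemma radial_loewner_solution_estimate:
  assumes cont: "continuous_on {0..t} \<zeta>" and unit: "\<And>s. s \<in> {0..t} \<Longrightarrow> norm (\<zeta> s) = 1"
    and t: "0 \<le> t" "t \<le> 1" and sol: "radial_loewner_solution \<zeta> t z \<gamma>"
    and r: "r < 1" "\<And>s. s \<in> {0..t} \<Longrightarrow> norm (\<gamma> s) \<le> r"
    and small: "\<And>n s. n \<in> {1..N} \<Longrightarrow> s \<in> {0..t} \<Longrightarrow>
      norm (integral {0..s} (\<lambda>u. inverse (\<zeta> u) ^ n)) \<le> \<delta>"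
  shows "norm (of_real (exp (- t)) * \<gamma> t - z) \<le>
    2 * r ^ Suc N / (1 - r) + 4 * (\<Sum>n=1..N. 1 + Suc n / (1 - r)) * \<delta>"
proof -
  define A where "A n s = integral {0..s} (\<lambda>u. inverse (\<zeta> u) ^ n)" for n s
  define v where "v s = - \<gamma> s * ((\<gamma> s + \<zeta> s) / (\<gamma> s - \<zeta> s))" for s
  define E where "E s = complex_of_real (exp (- s))" for s
  define x where "x s = \<gamma> s / \<zeta> s" for s
  define R where "R s = x s ^ Suc N / (1 - x s)" for s
  define G where "G n s = E s * \<gamma> s ^ Suc n" for n s
  define G' where "G' n s = E s * \<gamma> s ^ n * (of_nat (Suc n) * v s - \<gamma> s)" for n s
  define P where "P s = E s * \<gamma> s - 2 * (\<Sum>n=1..N. G n s * A n s)" for s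
  define P' where "P' s = 2 * E s * \<gamma> s * R s - 2 * (\<Sum>n=1..N. G' n s * A n s)" for s
  have r0: "0 \<le> r"
    by (rule order_trans[OF norm_ge_zero r(2)[of 0]]) (use t in simp)
  have nz: "\<zeta> s \<noteq> 0" "\<gamma> s \<noteq> \<zeta> s" "norm (x s) \<le> r" "x s \<noteq> 1" if "s \<in> {0..t}" for s
    using unit[OF that] r(1) r(2)[OF that] by (auto simp: x_def norm_divide)
  have d\<gamma>: "(\<gamma> has_vector_derivative v s) (at s within {0..t})" if "s \<in> {0..t}" for s
    using sol that unfolding radial_loewner_solution_def v_def by blast
  have dE: "(E has_vector_derivative - E s) (at s within {0..t})" for s
    unfolding E_def by (rule has_vector_derivative_of_real[THEN has_vector_derivative_eq_rhs])
      (auto intro!: derivative_eq_intros)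
  have dA: "(A n has_vector_derivative inverse (\<zeta> s) ^ n) (at s within {0..t})" if "s \<in> {0..t}" for n s
    unfolding A_def using that nz
    by (intro integral_has_vector_derivative continuous_intros cont) auto
  have dG: "(G n has_vector_derivative G' n s) (at s within {0..t})" if "s \<in> {0..t}" for n s
  proof -
    have "((\<lambda>x. x ^ Suc n) has_field_derivative of_nat (Suc n) * x ^ n) (at x within S)" for x :: complex and S
      by (auto intro!: derivative_eq_intros simp del: power_Suc)
    then have "((\<lambda>s. \<gamma> s ^ Suc n) has_vector_derivative v s * (of_nat (Suc n) * \<gamma> s ^ n)) (at s within {0..t})"
      using field_vector_diff_chain_within[OF d\<gamma>[OF that], of "\<lambda>x. x ^ Suc n"] by (simp add: o_def)
    from has_vector_derivative_mult[OF dE this] show ?thesis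
      unfolding G_def by (rule has_vector_derivative_eq_rhs) (simp add: G'_def algebra_simps)
  qed
  have dP: "(P has_vector_derivative P' s) (at s within {0..t})" if s: "s \<in> {0..t}" for s
  proof -
    have "(P has_vector_derivative (E s * v s + (- E s) * \<gamma> s)
        - 2 * (\<Sum>n=1..N. G n s * inverse (\<zeta> s) ^ n + G' n s * A n s)) (at s within {0..t})"
      unfolding P_def
      by (intro has_vector_derivative_diff has_vector_derivative_mult_right has_vector_derivative_sum
          has_vector_derivative_mult dE dA dG d\<gamma> s)
    moreover have "(E s * v s + (- E s) * \<gamma> s) - 2 * (\<Sum>n=1..N. G n s * inverse (\<zeta> s) ^ n + G' n s * A n s) = P' s"
    proof -
      \<comment> \<open>The factor \<open>exp (- s)\<close> removes the linear part of the field: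
        \<open>v - \<gamma> = 2 * \<gamma> * x / (1 - x)\<close> with
        \<open>x = \<gamma> / \<zeta>\<close>.\<close>
      have "E s * v s + (- E s) * \<gamma> s = 2 * E s * \<gamma> s * (x s / (1 - x s))"
        using nz[OF s] by (simp add: v_def x_def divide_simps) (simp add: algebra_simps)
      also have "x s / (1 - x s) = (\<Sum>n=1..N. x s ^ n) + R s"
        unfolding R_def using nz[OF s] by (intro geometric_split)
      finally have 1: "E s * v s + (- E s) * \<gamma> s = 2 * E s * \<gamma> s * ((\<Sum>n=1..N. x s ^ n) + R s)" .
      \<comment> \<open>As \<open>\<gamma> * x ^ n = \<gamma> ^ Suc n * \<zeta> ^ -n\<close>,
        differentiating the primitives \<open>A n\<close> in \<open>P\<close> cancels the whole
        partial sum. Only the remainder \<open>R\<close> and the terms with \<open>G'\<close>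
        survive.\<close>
      have 2: "(\<Sum>n=1..N. G n s * inverse (\<zeta> s) ^ n) = E s * \<gamma> s * (\<Sum>n=1..N. x s ^ n)"
        by (simp add: sum_distrib_left G_def x_def divide_inverse power_mult_distrib mult_ac)
      show ?thesis
        unfolding P'_def sum.distrib 1 2 by (simp only: ring_distribs) simp
    qed
    ultimately show ?thesis
      by simp
  qed
  have E1: "norm (E s) \<le> 1" if "s \<in> {0..t}" for s
    using that by (simp add: E_def)
  have \<gamma>1: "norm (\<gamma> s) \<le> 1" if "s \<in> {0..t}" for s
    using r(1) r(2)[OF that] by simp
  have A\<delta>: "norm (A n s) \<le> \<delta>" if "n \<in> {1..N}" "s \<in> {0..t}" for n s
    using small that by (simp add: A_def)
  have G1: "norm (G n s * A n s) \<le> \<delta>" if "n \<in> {1..N}" "s \<in> {0..t}" for n s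
  proof -
    have "norm (G n s) \<le> 1"
      unfolding G_def norm_mult norm_power using E1 \<gamma>1 that
      by (intro mult_le_one power_le_one zero_le_power norm_ge_zero)
    then show ?thesis
      unfolding norm_mult using A\<delta>[OF that] mult_left_le_one_le[of "norm (A n s)" "norm (G n s)"]
      by simp
  qed
  have v2: "norm (v s) \<le> 2 / (1 - r)" if s: "s \<in> {0..t}" for s
  proof -
    have "norm (v s) = norm (\<gamma> s) * (norm (\<gamma> s + \<zeta> s) / norm (\<gamma> s - \<zeta> s))"
      by (simp add: v_def norm_mult norm_divide)
    also have "\<dots> \<le> 1 * (2 / (1 - r))"
      using \<gamma>1[OF s] unit[OF s] r norm_triangle_ineq[of "\<gamma> s" "\<zeta> s"] norm_le_norm_diff_unit[OF unit[OF s] r(2)[OF s]]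
      by (intro mult_mono frac_le) auto
    finally show ?thesis by simp
  qed
  have G'1: "norm (G' n s * A n s) \<le> (1 + 2 * (Suc n / (1 - r))) * \<delta>" if n: "n \<in> {1..N}" and s: "s \<in> {0..t}" for n s
  proof -
    have "norm (of_nat (Suc n) * v s - \<gamma> s) \<le> norm (of_nat (Suc n) * v s) + norm (\<gamma> s)"
      by (rule norm_triangle_ineq4)
    also have "\<dots> \<le> Suc n * (2 / (1 - r)) + 1"
      unfolding norm_mult norm_of_nat by (intro add_mono mult_left_mono v2 \<gamma>1 s) simp
    finally have "norm (of_nat (Suc n) * v s - \<gamma> s) \<le> 1 + 2 * (Suc n / (1 - r))"
      by (simp add: mult.commute)
    moreover have "norm (E s * \<gamma> s ^ n) \<le> 1"
      unfolding norm_mult norm_power using E1 \<gamma>1 s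
      by (intro mult_le_one power_le_one zero_le_power norm_ge_zero)
    ultimately have "norm (G' n s) \<le> 1 * (1 + 2 * (Suc n / (1 - r)))"
      unfolding G'_def norm_mult[of "E s * \<gamma> s ^ n"] by (intro mult_mono) auto
    then show ?thesis
      unfolding norm_mult using A\<delta>[OF n s] r(1) by (intro mult_mono) auto
  qed
  \<comment> \<open>The first summand bounds the geometric remainder. In the second,
    \<open>1 + 2 * (Suc n / (1 - r))\<close> bounds \<open>G' n\<close>, using that \<open>v\<close>
    is at most \<open>2 / (1 - r)\<close>.\<close>
  define B where "B = 2 * r ^ Suc N / (1 - r) + 2 * (\<Sum>n=1..N. (1 + 2 * (Suc n / (1 - r))) * \<delta>)"
  have P'B: "norm (P' s) \<le> B" if s: "s \<in> {0..t}" for s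
  proof -
    have "norm (1 - x s) \<ge> 1 - r"
      using norm_triangle_ineq2[of 1 "x s"] nz(3)[OF s] by simp
    then have R: "norm (R s) \<le> r ^ Suc N / (1 - r)"
      unfolding R_def norm_divide norm_power using nz(3)[OF s] r(1) r0
      by (intro frac_le power_mono) auto
    have "norm (2 * E s * \<gamma> s * R s) = 2 * ((norm (E s) * norm (\<gamma> s)) * norm (R s))"
      by (simp add: norm_mult)
    also have "\<dots> \<le> 2 * (1 * (r ^ Suc N / (1 - r)))"
      using R E1[OF s] \<gamma>1[OF s] r0 r(1) by (intro mult_left_mono mult_mono mult_le_one) auto
    finally have "norm (2 * E s * \<gamma> s * R s) \<le> 2 * r ^ Suc N / (1 - r)"
      by simp
    moreover have "norm (2 * (\<Sum>n=1..N. G' n s * A n s)) \<le> 2 * (\<Sum>n=1..N. (1 + 2 * (Suc n / (1 - r))) * \<delta>)"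
      unfolding norm_mult[of 2] using G'1[OF _ s] by (intro mult_mono sum_norm_le) auto
    ultimately show ?thesis
      unfolding P'_def B_def by (rule order_trans[OF norm_triangle_ineq4 add_mono])
  qed
  have "norm (P t - P 0) \<le> B * (t - 0)"
    using t(1) dP P'B by (rule norm_diff_le_vector_derivative_bound)
  also have "\<dots> \<le> B"
  proof -
    have "0 \<le> B"
      by (rule order_trans[OF norm_ge_zero P'B[of 0]]) (use t in simp)
    then show ?thesis
      using t by (simp add: mult_left_le)
  qed
  finally have PB: "norm (P t - P 0) \<le> B" .
  have "\<gamma> 0 = z"
    using sol by (simp add: radial_loewner_solution_def)
  \<comment> \<open>At time 0 the primitives vanish, so \<open>P 0 = z\<close>; at time
    \<open>t\<close> the correction terms remain and cost a further
    \<open>2 * N * \<delta>\<close>.\<close>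
  then have "E t * \<gamma> t - z = (P t - P 0) + 2 * (\<Sum>n=1..N. G n t * A n t)"
    by (simp add: P_def E_def A_def)
  also have "norm \<dots> \<le> B + 2 * (\<Sum>n=1..N. \<delta>)"
  proof (intro norm_triangle_mono PB)
    have "norm (\<Sum>n=1..N. G n t * A n t) \<le> (\<Sum>n=1..N. \<delta>)"
      by (intro sum_norm_le G1) (use t in auto)
    then show "norm (2 * (\<Sum>n=1..N. G n t * A n t)) \<le> 2 * (\<Sum>n=1..N. \<delta>)"
      unfolding norm_mult[of 2] by simp
  qed
  also have "\<dots> = 2 * r ^ Suc N / (1 - r) + 4 * (\<Sum>n=1..N. 1 + Suc n / (1 - r)) * \<delta>"
  proof -
    have "2 * (\<Sum>n=1..N. (1 + 2 * (Suc n / (1 - r))) * \<delta>) + 2 * (\<Sum>n=1..N. \<delta>)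
        = (\<Sum>n=1..N. 2 * ((1 + 2 * (Suc n / (1 - r))) * \<delta>) + 2 * \<delta>)"
      by (simp only: sum_distrib_left sum.distrib)
    also have "\<dots> = (\<Sum>n=1..N. 4 * (1 + Suc n / (1 - r)) * \<delta>)"
      by (intro sum.cong refl) (simp only: ring_distribs)
    also have "\<dots> = 4 * (\<Sum>n=1..N. 1 + Suc n / (1 - r)) * \<delta>"
      by (simp only: sum_distrib_left sum_distrib_right)
    finally show ?thesis
      by (simp add: B_def)
  qed
  finally show ?thesis
    by (simp add: E_def)
qed

text \<open>A compact \<open>K\<close> lies over a disc of radius \<open>r < 1\<close>, and the
  curve ending at \<open>w\<close> stays in the disc of radius \<open>norm w\<close>, so the
  estimate is uniform on \<open>K\<close>. First \<open>N\<close> is chosen to make the geometric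
  remainder small, then finitely many averages are made small. Continuity is required only
  eventually because a negative index \<open>\<kappa>\<close> would read the Brownian path at
  negative times, where it is unconstrained.\<close>

lemma uniform_caratheodory_limit_radial_loewner_chain:
  fixes \<zeta> :: "'i \<Rightarrow> real \<Rightarrow> complex"
  assumes cont: "\<forall>\<^sub>F i in F. continuous_on {0..1} (\<zeta> i)" and unit: "\<And>i s. norm (\<zeta> i s) = 1"
    and avg: "\<And>n. 1 \<le> n \<Longrightarrow>
      uniform_limit {0..1} (\<lambda>i s. integral {0..s} (\<lambda>u. inverse (\<zeta> i u) ^ n)) (\<lambda>_. 0) F"
  shows "uniform_caratheodory_limit (\<lambda>i. radial_loewner_chain (\<zeta> i))
    (\<lambda>t z. complex_of_real (exp (- t)) * z) F"
  unfolding uniform_caratheodory_limit_def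
proof (intro allI impI uniform_limitI)
  fix K :: "(complex \<times> real) set" and e :: real
  assume K: "compact K \<and> K \<subseteq> ball 0 1 \<times> {0..1}" and e: "0 < e"
  obtain r where r: "0 \<le> r" "r < 1" "\<And>w t. (w, t) \<in> K \<Longrightarrow> norm w \<le> r"
  proof (cases "K = {}")
    case True
    then show thesis
      using that[of 0] by simp
  next
    case False
    have "continuous_on K (\<lambda>x. norm (fst x))"
      by (intro continuous_intros)
    then obtain x where x: "x \<in> K" "\<forall>y\<in>K. norm (fst y) \<le> norm (fst x)"
      using continuous_attains_sup[OF conjunct1[OF K] False] by blast
    show thesis
    proof
      show "norm (fst x) < 1"
        using x(1) K by (auto dest!: subsetD)
      show "norm w \<le> norm (fst x)" if "(w, t) \<in> K" for w t
        using x(2) that by fastforce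
    qed simp
  qed
  have "(\<lambda>N. 2 * r ^ Suc N / (1 - r)) \<longlonglongrightarrow> 2 * 0 / (1 - r)"
    using r by (intro tendsto_intros LIMSEQ_Suc LIMSEQ_realpow_zero) auto
  then have "\<forall>\<^sub>F N in sequentially. 2 * r ^ Suc N / (1 - r) < e / 2"
    using e by (intro order_tendstoD) auto
  then obtain N where N: "2 * r ^ Suc N / (1 - r) < e / 2"
    unfolding eventually_sequentially by blast
  define C where "C = 4 * (\<Sum>n=1..N. 1 + Suc n / (1 - r))"
  have C: "0 \<le> C"
    unfolding C_def using r by (intro mult_nonneg_nonneg sum_nonneg) auto
  \<comment> \<open>The summand 1 keeps the denominator positive when \<open>N = 0\<close>, where
    \<open>C = 0\<close>.\<close>
  define \<delta> where "\<delta> = e / 2 / (C + 1)"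
  have \<delta>: "0 < \<delta>" "C * \<delta> \<le> e / 2"
    using C e by (auto simp: \<delta>_def field_simps)
  have "\<forall>\<^sub>F i in F. \<forall>n\<in>{1..N}. \<forall>s\<in>{0..1}. dist (integral {0..s} (\<lambda>u. inverse (\<zeta> i u) ^ n)) 0 < \<delta>"
    using avg \<delta>(1) by (intro eventually_ball_finite) (auto simp: uniform_limit_iff)
  with cont show "\<forall>\<^sub>F i in F. \<forall>x\<in>K. dist (case x of (z, t) \<Rightarrow> radial_loewner_chain (\<zeta> i) t z)
      (case x of (z, t) \<Rightarrow> complex_of_real (exp (- t)) * z) < e"
  proof eventually_elim
    case (elim i)
    have "dist (radial_loewner_chain (\<zeta> i) t w) (complex_of_real (exp (- t)) * w) < e" if "(w, t) \<in> K" for w t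
    proof -
      have t: "0 \<le> t" "t \<le> 1" and w: "norm w < 1" "norm w \<le> r"
        using that K r(2) r(3)[OF that] by (auto dest!: subsetD)
      have cont_t: "continuous_on {0..t} (\<zeta> i)"
        using elim(1) t by (auto intro: continuous_on_subset)
      obtain \<gamma> where \<gamma>: "radial_loewner_solution (\<zeta> i) t (\<gamma> 0) \<gamma>" "\<gamma> t = w"
        "\<And>s. s \<in> {0..t} \<Longrightarrow> norm (\<gamma> s) \<le> norm w"
        using radial_loewner_solution_exists[OF cont_t unit t(1) w(1)] by blast
      have "norm (of_real (exp (- t)) * \<gamma> t - \<gamma> 0) \<le> 2 * r ^ Suc N / (1 - r) + C * \<delta>"
        unfolding C_def
      proof (rule radial_loewner_solution_estimate[OF cont_t unit t \<gamma>(1) r(2)])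
        show "norm (\<gamma> s) \<le> r" if "s \<in> {0..t}" for s
          using \<gamma>(3)[OF that] w(2) by simp
        show "norm (integral {0..s} (\<lambda>u. inverse (\<zeta> i u) ^ n)) \<le> \<delta>"
          if "n \<in> {1..N}" "s \<in> {0..t}" for n s
        proof -
          have "s \<in> {0..1}"
            using that t by auto
          then show ?thesis
            using elim(2) that(1) by (auto simp: less_imp_le)
        qed
      qed
      moreover have "radial_loewner_chain (\<zeta> i) t w = \<gamma> 0"
        using radial_loewner_chain_eqI[OF cont_t unit t(1) \<gamma>(1)] \<gamma>(2) by simp
      ultimately show ?thesis
        using N \<delta>(2) \<gamma>(2) by (simp add: dist_norm norm_minus_commute)
    qed
    then show ?case by auto
  qed
qed

section \<open>From long-time means to rescaled primitives\<close>

text \<open>Substitution turns the integral over \<open>{0..s}\<close> into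
  \<open>1 / \<kappa>\<close> times the integral of \<open>c\<close> over
  \<open>{0..\<kappa> * s}\<close>. The mean handles large \<open>\<kappa> * s\<close>; for small
  \<open>\<kappa> * s\<close> the bound on \<open>c\<close> and the factor
  \<open>1 / \<kappa>\<close> suffice.\<close>

lemma uniform_limit_integral_rescaled:
  fixes c :: "real \<Rightarrow> 'a::euclidean_space"
  assumes cont: "continuous_on {0..} c" and bound: "\<And>s. 0 \<le> s \<Longrightarrow> norm (c s) \<le> 1"
    and mean: "((\<lambda>T. integral {0..T} c /\<^sub>R T) \<longlongrightarrow> 0) at_top"
  shows "uniform_limit {0..1} (\<lambda>\<kappa> s. integral {0..s} (\<lambda>u. c (\<kappa> * u))) (\<lambda>_. 0) at_top"
proof (rule uniform_limitI)
  fix e :: real assume e: "0 < e"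
  then have "\<forall>\<^sub>F T in at_top. norm (integral {0..T} c /\<^sub>R T) < e / 2"
    using tendstoD[OF mean, of "e / 2"] by simp
  then obtain T0 where T0: "\<And>T. T \<ge> T0 \<Longrightarrow> norm (integral {0..T} c /\<^sub>R T) < e / 2"
    by (auto simp: eventually_at_top_linorder)
  define T1 where "T1 = max T0 1"
  \<comment> \<open>Times up to \<open>T1\<close>, at which the mean need not be small yet, are
    absorbed by the constant; this gives uniformity down to \<open>s = 0\<close>.\<close>
  have T1: "norm (integral {0..T} c) \<le> T1 + e / 2 * T" if T: "0 \<le> T" for T
  proof (cases "T \<le> T1")
    case True
    have int: "c integrable_on {0..T}"
      using cont by (intro integrable_continuous_interval) (auto intro: continuous_on_subset)
    have "norm (integral {0..T} c) \<le> integral {0..T} (\<lambda>_. 1)"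
      by (rule integral_norm_bound_integral) (use int bound in auto)
    then show ?thesis
      using True T e by (simp add: add_increasing2)
  next
    case False
    then have T: "T0 \<le> T" "0 < T" "0 \<le> T1"
      by (auto simp: T1_def)
    have "norm (integral {0..T} c) < e / 2 * T"
      using T0[OF T(1)] T(2) by (simp add: field_simps)
    then show ?thesis
      using T(3) by linarith
  qed
  show "\<forall>\<^sub>F \<kappa> in at_top. \<forall>s\<in>{0..1}. dist (integral {0..s} (\<lambda>u. c (\<kappa> * u))) 0 < e"
    \<comment> \<open>Past this threshold \<open>T1 / \<kappa> < e / 2\<close>; the other half of
      \<open>e\<close> pays for the linear term.\<close>
    using eventually_gt_at_top[of "2 * T1 / e"]
  proof eventually_elim
    case (elim \<kappa>)
    have "0 < T1"
      by (simp add: T1_def)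
    then have \<kappa>: "0 < \<kappa>" "T1 < e / 2 * \<kappa>"
      using elim e less_trans[of 0 "2 * T1 / e" \<kappa>] by (auto simp: field_simps)
    have "norm (integral {0..s} (\<lambda>u. c (\<kappa> * u))) < e" if s: "s \<in> {0..1}" for s
    proof -
      have "c integrable_on {0..\<kappa> * s}"
        using cont by (intro integrable_continuous_interval) (auto intro: continuous_on_subset)
      then have "((\<lambda>u. c (\<kappa> * u)) has_integral integral {0..\<kappa> * s} c /\<^sub>R \<kappa>) {0..s}"
        using has_integral_stretch_real[OF integrable_integral, of c 0 "\<kappa> * s" \<kappa>] \<kappa>(1) s
        by (simp add: field_simps)
      then have "norm (integral {0..s} (\<lambda>u. c (\<kappa> * u))) = norm (integral {0..\<kappa> * s} c) / \<kappa>"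
        using \<kappa>(1) by (simp add: integral_unique divide_inverse)
      also have "\<dots> \<le> (T1 + e / 2 * (\<kappa> * s)) / \<kappa>"
        using T1[of "\<kappa> * s"] \<kappa>(1) s by (intro divide_right_mono) auto
      also have "\<dots> \<le> (T1 + e / 2 * \<kappa>) / \<kappa>"
        using s e \<kappa>(1) by (intro divide_right_mono add_left_mono mult_left_mono) (auto intro: mult_left_le)
      also have "\<dots> < (e / 2 * \<kappa> + e / 2 * \<kappa>) / \<kappa>"
        using \<kappa> by (intro divide_strict_right_mono add_strict_right_mono)
      also have "\<dots> = e"
        using \<kappa>(1) by simp
      finally show ?thesis .
    qed
    then show ?case by simp
  qed
qed

section \<open>Time means of Brownian motion on the circle\<close>

text \<open>Rounding \<open>t\<close> down to the grid of mesh \<open>1 / Suc n\<close> gives a map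
  assembled from countably many measurable ones, and path continuity makes these maps converge
  pointwise.\<close>

lemma borel_measurable_caratheodory:
  fixes Y :: "real \<Rightarrow> 'a \<Rightarrow> 'b::{metric_space}"
  assumes meas [measurable]: "\<And>t. Y t \<in> borel_measurable M"
    and cont: "\<And>\<omega>. \<omega> \<in> space M \<Longrightarrow> continuous_on UNIV (\<lambda>t. Y t \<omega>)"
  shows "(\<lambda>(t, \<omega>). Y t \<omega>) \<in> borel_measurable (borel \<Otimes>\<^sub>M M)"
proof (rule borel_measurable_LIMSEQ_metric)
  define u where "u n = (\<lambda>(t :: real, \<omega>). Y (\<lfloor>real (Suc n) * t\<rfloor> / real (Suc n)) \<omega>)" for n
  show "u n \<in> borel_measurable (borel \<Otimes>\<^sub>M M)" for n
  proof -
    have "(\<lambda>x. Y (real_of_int (i :: int) / real (Suc n)) (snd x)) \<in> borel_measurable (borel \<Otimes>\<^sub>M M)" for i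
      by measurable
    then have "(\<lambda>x. Y (\<lfloor>real (Suc n) * fst x\<rfloor> / real (Suc n)) (snd x)) \<in> borel_measurable (borel \<Otimes>\<^sub>M M)"
      by (rule measurable_compose_countable) measurable
    then show ?thesis
      by (simp add: u_def case_prod_beta')
  qed
  fix x assume "x \<in> space ((borel :: real measure) \<Otimes>\<^sub>M M)"
  then obtain t \<omega> where x: "x = (t, \<omega>)" "\<omega> \<in> space M"
    by (auto simp: space_pair_measure)
  have "(\<lambda>n. \<lfloor>real (Suc n) * t\<rfloor> / real (Suc n)) \<longlonglongrightarrow> t"
  proof (rule LIM_zero_cancel, rule Lim_null_comparison)
    show "\<forall>\<^sub>F n in sequentially. norm (\<lfloor>real (Suc n) * t\<rfloor> / real (Suc n) - t) \<le> 1 / real (Suc n)"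
    proof (rule always_eventually, rule allI)
      fix n
      have "\<bar>\<lfloor>real (Suc n) * t\<rfloor> - real (Suc n) * t\<bar> \<le> 1"
        by linarith
      then have "\<bar>\<lfloor>real (Suc n) * t\<rfloor> - real (Suc n) * t\<bar> / real (Suc n) \<le> 1 / real (Suc n)"
        by (intro divide_right_mono) auto
      moreover have "\<lfloor>real (Suc n) * t\<rfloor> / real (Suc n) - t = (\<lfloor>real (Suc n) * t\<rfloor> - real (Suc n) * t) / real (Suc n)"
        by (simp add: diff_divide_distrib)
      ultimately show "norm (\<lfloor>real (Suc n) * t\<rfloor> / real (Suc n) - t) \<le> 1 / real (Suc n)"
        by (simp only: real_norm_def abs_divide abs_of_nat)
    qed
  qed (rule lim_1_over_n[THEN LIMSEQ_Suc])
  then have "(\<lambda>n. Y (\<lfloor>real (Suc n) * t\<rfloor> / real (Suc n)) \<omega>) \<longlonglongrightarrow> Y t \<omega>"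
    using cont[OF x(2)] continuous_on_tendsto_compose[of UNIV "\<lambda>t. Y t \<omega>"] by auto
  then show "(\<lambda>n. u n x) \<longlonglongrightarrow> (case x of (t, \<omega>) \<Rightarrow> Y t \<omega>)"
    by (simp add: u_def x)
qed

text \<open>The square expands as a double integral of
  \<open>f s \<omega> * cnj (f r \<omega>)\<close>, and boundedness on finite measures justifies
  moving the \<open>\<omega>\<close>-integral inside. The identity is stated in
  \<open>complex\<close> since the covariance kernel is complex-valued before it is
  computed.\<close>

lemma integral_norm_square_integral:
  fixes f :: "'a \<Rightarrow> 'b \<Rightarrow> complex"
  assumes "finite_measure L" "finite_measure M"
    and f [measurable]: "(\<lambda>(s, \<omega>). f s \<omega>) \<in> borel_measurable (L \<Otimes>\<^sub>M M)"
    and bound: "\<And>s \<omega>. norm (f s \<omega>) \<le> 1"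
  shows "complex_of_real (LINT \<omega>|M. (norm (LINT s|L. f s \<omega>))\<^sup>2)
    = (LINT s|L. LINT r|L. LINT \<omega>|M. f s \<omega> * cnj (f r \<omega>))"
proof -
  interpret L: finite_measure L by fact
  interpret M: finite_measure M by fact
  interpret P: pair_sigma_finite L M ..
  interpret F: finite_measure "L \<Otimes>\<^sub>M M"
    by (rule finite_measure_pair_measure) fact+
  have sq: "complex_of_real ((norm (LINT s|L. f s \<omega>))\<^sup>2) = (LINT s|L. LINT r|L. f s \<omega> * cnj (f r \<omega>))" for \<omega>
    by (simp add: complex_norm_square [symmetric])
  have "(\<lambda>\<omega>. LINT r|L. f r \<omega>) \<in> borel_measurable M"
    using measurable_pair_swap[OF f] by (intro L.borel_measurable_lebesgue_integral) simp
  note [measurable] = measurable_compose[OF measurable_snd this]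
  have [measurable]: "cnj \<in> borel_measurable borel"
    by (intro borel_measurable_continuous_onI continuous_intros)
  have b1: "norm (f s \<omega> * cnj (f r \<omega>)) \<le> 1" for s r \<omega>
    using bound by (simp add: norm_mult mult_le_one)
  have b2: "norm (LINT r|L. f s \<omega> * cnj (f r \<omega>)) \<le> measure L (space L)" for s \<omega>
  proof -
    have "norm (LINT r|L. f s \<omega> * cnj (f r \<omega>)) \<le> (LINT r|L. norm (f s \<omega> * cnj (f r \<omega>)))"
      by (rule integral_norm_bound)
    also have "\<dots> \<le> (LINT r|L. 1)"
      by (rule integral_mono') (use b1 in auto)
    finally show ?thesis by simp
  qed
  have "complex_of_real (LINT \<omega>|M. (norm (LINT s|L. f s \<omega>))\<^sup>2)
      = (LINT \<omega>|M. LINT s|L. LINT r|L. f s \<omega> * cnj (f r \<omega>))"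
    by (simp only: sq flip: integral_complex_of_real)
  \<comment> \<open>The \<open>\<omega>\<close>-integral passes the outer \<open>s\<close>-integral
    first, then for fixed \<open>s\<close> the inner \<open>r\<close>-integral.\<close>
  also have "\<dots> = (LINT s|L. LINT \<omega>|M. LINT r|L. f s \<omega> * cnj (f r \<omega>))"
    by (intro P.Fubini_integral F.integrable_const_bound[where B = "measure L (space L)"])
      (use b2 in auto)
  also have "\<dots> = (LINT s|L. LINT r|L. LINT \<omega>|M. f s \<omega> * cnj (f r \<omega>))"
  proof (rule Bochner_Integration.integral_cong[OF refl])
    fix s assume [measurable]: "s \<in> space L"
    show "(LINT \<omega>|M. LINT r|L. f s \<omega> * cnj (f r \<omega>)) = (LINT r|L. LINT \<omega>|M. f s \<omega> * cnj (f r \<omega>))"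
      by (intro P.Fubini_integral F.integrable_const_bound[where B = 1]) (use b1 in auto)
  qed
  finally show ?thesis .
qed

text \<open>Splitting at \<open>r = s\<close> gives two exponential integrals of at most
  \<open>1 / b\<close> each. The bound does not depend on \<open>T\<close>, which is why the second
  moment grows only linearly.\<close>

lemma integral_exp_neg_abs_le:
  fixes b s T :: real
  assumes b: "0 < b" and s: "0 \<le> s" "s \<le> T"
  shows "(LINT r|restrict_space lborel {0..T}. exp (- b * \<bar>s - r\<bar>)) \<le> 2 / b"
proof -
  have "((\<lambda>r. exp (- b * \<bar>s - r\<bar>)) has_integral exp (- b * (s - s)) / b - exp (- b * (s - 0)) / b) {0..s}"
  proof (rule has_integral_eq[rotated], rule fundamental_theorem_of_calculus)
    show "((\<lambda>r. exp (- b * (s - r)) / b) has_vector_derivative exp (- b * (s - r))) (at r within {0..s})" for r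
      using b by (auto intro!: derivative_eq_intros simp flip: has_real_derivative_iff_has_vector_derivative)
  qed (use s in auto)
  moreover have "((\<lambda>r. exp (- b * \<bar>s - r\<bar>)) has_integral - exp (- b * (T - s)) / b - - exp (- b * (s - s)) / b) {s..T}"
  proof (rule has_integral_eq[rotated], rule fundamental_theorem_of_calculus)
    show "((\<lambda>r. - exp (- b * (r - s)) / b) has_vector_derivative exp (- b * (r - s))) (at r within {s..T})" for r
      using b by (auto intro!: derivative_eq_intros simp flip: has_real_derivative_iff_has_vector_derivative)
  qed (use s in auto)
  ultimately have "((\<lambda>r. exp (- b * \<bar>s - r\<bar>)) has_integral
      (exp (- b * (s - s)) / b - exp (- b * (s - 0)) / b) + (- exp (- b * (T - s)) / b - - exp (- b * (s - s)) / b)) {0..T}"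
    using s by (intro has_integral_combine)
  then have "integral {0..T} (\<lambda>r. exp (- b * \<bar>s - r\<bar>)) = (2 - exp (- b * s) - exp (- b * (T - s))) / b"
    using b by (simp add: integral_unique diff_divide_distrib)
  also have "\<dots> \<le> 2 / b"
    using b by (intro divide_right_mono) (auto simp: add_nonneg_nonneg intro: order_trans[of _ 0])
  finally have "integral {0..T} (\<lambda>r. exp (- b * \<bar>s - r\<bar>)) \<le> 2 / b" .
  moreover have "set_integrable lborel {0..T} (\<lambda>r. exp (- b * \<bar>s - r\<bar>))"
    by (intro borel_integrable_atLeastAtMost' continuous_intros)
  ultimately show ?thesis
    using set_borel_integral_eq_integral(2)[of "{0..T}" "\<lambda>r. exp (- b * \<bar>s - r\<bar>)"]
    by (simp add: integral_restrict_space set_lebesgue_integral_def)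
qed

text \<open>With \<open>m\<close> the integer part of \<open>sqrt T\<close>, one has
  \<open>T - m\<^sup>2 = (sqrt T - m) * (sqrt T + m) \<le> 2 * sqrt T\<close>, so passing from
  \<open>m\<^sup>2\<close> to \<open>T\<close> changes the integral by \<open>O(sqrt T)\<close>.
  Squares are sparse enough for summable moments and dense enough for this interpolation.\<close>

lemma tendsto_mean_of_squares:
  fixes c :: "real \<Rightarrow> 'a::euclidean_space"
  assumes int: "\<And>T. 0 \<le> T \<Longrightarrow> c integrable_on {0..T}" and bound: "\<And>s. 0 \<le> s \<Longrightarrow> norm (c s) \<le> 1"
    and sq: "(\<lambda>k. integral {0..(real k)\<^sup>2} c /\<^sub>R (real k)\<^sup>2) \<longlonglongrightarrow> 0"
  shows "((\<lambda>T. integral {0..T} c /\<^sub>R T) \<longlongrightarrow> 0) at_top"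
proof (rule Lim_null_comparison)
  define k where "k T = nat \<lfloor>sqrt T\<rfloor>" for T
  define g where "g n = norm (integral {0..(real n)\<^sup>2} c /\<^sub>R (real n)\<^sup>2)" for n
  have "filterlim k sequentially at_top"
    unfolding k_def
    by (intro filterlim_compose[OF filterlim_nat_sequentially] filterlim_compose[OF filterlim_floor_sequentially] sqrt_at_top)
  then have "((\<lambda>T. g (k T)) \<longlongrightarrow> 0) at_top"
    unfolding g_def by (rule filterlim_compose[OF tendsto_norm_zero[OF sq]])
  moreover have "((\<lambda>T. 2 / sqrt T) \<longlongrightarrow> 0) at_top"
    by (intro tendsto_divide_0[OF tendsto_const] filterlim_at_top_imp_at_infinity sqrt_at_top)
  ultimately show "((\<lambda>T. g (k T) + 2 / sqrt T) \<longlongrightarrow> 0) at_top"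
    by (auto intro: tendsto_add_zero)
  show "\<forall>\<^sub>F T in at_top. norm (integral {0..T} c /\<^sub>R T) \<le> g (k T) + 2 / sqrt T"
    using eventually_ge_at_top[of 1]
  proof eventually_elim
    case (elim T)
    define m where "m = real (k T)"
    have "1 \<le> sqrt T"
      using elim by simp
    then have m: "1 \<le> m" "m \<le> sqrt T" "sqrt T \<le> m + 1"
      unfolding m_def k_def by (simp_all add: le_nat_iff)
    have m2: "m\<^sup>2 \<le> T" "0 < m\<^sup>2"
      using power_mono[OF m(2), of 2] m(1) elim by auto
    have "integral {0..m\<^sup>2} c + integral {m\<^sup>2..T} c = integral {0..T} c"
      using m2 elim by (intro Henstock_Kurzweil_Integration.integral_combine int) auto
    moreover have "norm (integral {m\<^sup>2..T} c) \<le> integral {m\<^sup>2..T} (\<lambda>_. 1)"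
    proof (rule integral_norm_bound_integral)
      show "c integrable_on {m\<^sup>2..T}"
        by (rule integrable_on_subinterval[OF int[of T]]) (use elim in auto)
      show "norm (c x) \<le> 1" if "x \<in> {m\<^sup>2..T}" for x
        using that order_trans[OF zero_le_power2, of m x] by (intro bound) auto
    qed auto
    ultimately have "norm (integral {0..T} c) \<le> norm (integral {0..m\<^sup>2} c) + (T - m\<^sup>2)"
      using norm_triangle_ineq[of "integral {0..m\<^sup>2} c" "integral {m\<^sup>2..T} c"] m2 by simp
    then have "norm (integral {0..T} c) / T \<le> norm (integral {0..m\<^sup>2} c) / T + (T - m\<^sup>2) / T"
      using elim by (simp add: divide_right_mono flip: add_divide_distrib)
    also have "norm (integral {0..m\<^sup>2} c) / T \<le> norm (integral {0..m\<^sup>2} c) / m\<^sup>2"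
      using m2 elim by (intro divide_left_mono mult_pos_pos) auto
    also have "(T - m\<^sup>2) / T \<le> 2 / sqrt T"
    proof -
      have "T - m\<^sup>2 = (sqrt T - m) * (sqrt T + m)"
        using elim by (simp add: algebra_simps flip: power2_eq_square)
      also have "\<dots> \<le> 1 * (2 * sqrt T)"
        using m by (intro mult_mono) auto
      finally have "(T - m\<^sup>2) / T \<le> 2 * sqrt T / T"
        using elim by (simp add: divide_right_mono)
      also have "\<dots> = 2 / sqrt T"
        using elim by (simp add: field_simps)
      finally show ?thesis .
    qed
    finally show ?case
      using elim by (simp add: g_def m_def divide_inverse mult.commute)
  qed
qed

section \<open>Second moments and almost sure time means\<close>

context standard_brownian_motion
begin

lemma integrable_cis:
  assumes "X \<in> borel_measurable M"
  shows "integrable M (\<lambda>\<omega>. cis (X \<omega>))"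
  using assms by (intro integrable_const_bound[where B = 1] measurable_compose[OF assms]
      borel_measurable_continuous_onI continuous_intros) auto

text \<open>Dividing the increment by its standard deviation reduces the claim to the characteristic
  function of the standard normal law. Both orders of \<open>s\<close> and \<open>t\<close> are
  covered because the covariance is integrated over a full square.\<close>

lemma expectation_cis_increment:
  assumes "0 \<le> s" "0 \<le> t"
  shows "expectation (\<lambda>\<omega>. cis (a * (W t \<omega> - W s \<omega>))) = of_real (exp (- (a\<^sup>2 / 2) * \<bar>t - s\<bar>))"
proof -
  have less: "expectation (\<lambda>\<omega>. cis (a * (W t \<omega> - W s \<omega>))) = of_real (exp (- (a\<^sup>2 / 2) * (t - s)))"
    if "0 \<le> s" "s < t" for a s t
  proof -
    define \<sigma> where "\<sigma> = sqrt (t - s)"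
    have \<sigma>: "0 < \<sigma>" "\<sigma>\<^sup>2 = t - s"
      using that by (auto simp: \<sigma>_def)
    define Z where "Z \<omega> = (W t \<omega> - W s \<omega>) / \<sigma>" for \<omega>
    have Z: "distributed M lborel Z std_normal_density"
      using gaussian_increments[OF that] normal_standard_normal_convert[OF \<sigma>(1), of "\<lambda>\<omega>. W t \<omega> - W s \<omega>" 0]
      by (simp add: \<sigma>_def Z_def [abs_def])
    then have "distr M lborel Z = std_normal_distribution"
      by (simp add: distributed_distr_eq_density)
    have "complex_of_real (exp (- (a\<^sup>2 / 2) * (t - s))) = complex_of_real (exp (- ((a * \<sigma>)\<^sup>2) / 2))"
      by (simp add: power_mult_distrib \<sigma>(2))
    also have "\<dots> = char (distr M lborel Z) (a * \<sigma>)"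
      using char_std_normal_distribution \<open>distr M lborel Z = std_normal_distribution\<close> by metis
    also have "\<dots> = expectation (\<lambda>\<omega>. iexp (a * \<sigma> * Z \<omega>))"
      unfolding char_def using distributed_measurable[OF Z] by (intro integral_distr) auto
    also have "\<dots> = expectation (\<lambda>\<omega>. cis (a * (W t \<omega> - W s \<omega>)))"
      using \<sigma>(1) by (simp add: Z_def cis_conv_exp)
    finally show ?thesis ..
  qed
  consider "s < t" | "s = t" | "t < s"
    by linarith
  then show ?thesis
  proof cases
    \<comment> \<open>Reversing the increment replaces \<open>a\<close> by \<open>- a\<close>, and
      only \<open>a\<^sup>2\<close> enters the value.\<close>
    case 3
    have "expectation (\<lambda>\<omega>. cis (a * (W t \<omega> - W s \<omega>))) = expectation (\<lambda>\<omega>. cis ((- a) * (W s \<omega> - W t \<omega>)))"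
      by (simp add: algebra_simps)
    then show ?thesis
      using less[OF assms(2) 3, of "- a"] 3 by simp
  qed (use less[OF assms(1)] in \<open>auto simp: prob_space\<close>)
qed

text \<open>\<open>Y\<close> needs continuous paths for every \<open>\<omega>\<close> to be jointly measurable, which Fubini requires.\<close>

lemma exists_continuous_version:
  obtains Y :: "real \<Rightarrow> 'a \<Rightarrow> real" where "\<And>t. Y t \<in> borel_measurable M"
    and "\<And>\<omega>. continuous_on UNIV (\<lambda>t. Y t \<omega>)"
    and "AE \<omega> in M. continuous_on {0..} (\<lambda>t. W t \<omega>) \<and> (\<forall>t\<ge>0. Y t \<omega> = W t \<omega>)"
proof -
  obtain N where N: "N \<in> null_sets M" "{\<omega> \<in> space M. \<not> continuous_on {0..} (\<lambda>t. W t \<omega>)} \<subseteq> N"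
    using continuous_paths by (auto elim!: AE_E intro: null_setsI)
  \<comment> \<open>The value 0 on the null set and the constant extension by \<open>W 0\<close> to
    negative times make every path continuous on the whole line.\<close>
  define Y where "Y t \<omega> = (if \<omega> \<in> space M - N then W (max 0 t) \<omega> else 0)" for t \<omega>
  show thesis
  proof
    show "Y t \<in> borel_measurable M" for t
    proof -
      have "space M - N \<in> sets M"
        using N(1) by auto
      then show ?thesis
        unfolding Y_def using random_variable[of "max 0 t"] by (intro measurable_If_set) auto
    qed
    show "continuous_on UNIV (\<lambda>t. Y t \<omega>)" for \<omega>
    proof (cases "\<omega> \<in> space M - N")
      case True
      then have "continuous_on {0..} (\<lambda>t. W t \<omega>)"
        using N(2) by auto
      then have "continuous_on UNIV (\<lambda>t. W (max 0 t) \<omega>)"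
        by (rule continuous_on_compose2) (auto intro!: continuous_intros)
      then show ?thesis
        using True by (simp add: Y_def)
    next
      case False
      then have Y0: "Y t \<omega> = 0" for t
        by (auto simp: Y_def)
      show ?thesis
        unfolding Y0 by simp
    qed
    show "AE \<omega> in M. continuous_on {0..} (\<lambda>t. W t \<omega>) \<and> (\<forall>t\<ge>0. Y t \<omega> = W t \<omega>)"
      using AE_not_in[OF N(1)] continuous_paths AE_space by eventually_elim (auto simp: Y_def max_def)
  qed
qed

text \<open>Links the gauge integral of the Loewner estimates with the Bochner integral on which
  Fubini operates.\<close>

lemma integral_cis_eq_lebesgue:
  fixes y :: "real \<Rightarrow> real"
  assumes "continuous_on UNIV y"
  shows "integral {0..T} (\<lambda>s. cis (a * y s)) = (LINT s|restrict_space lborel {0..T}. cis (a * y s))"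
proof -
  have "set_integrable lborel {0..T} (\<lambda>s. cis (a * y s))"
    by (intro borel_integrable_atLeastAtMost' continuous_intros continuous_on_subset[OF assms]) auto
  then show ?thesis
    using set_borel_integral_eq_integral(2)[of "{0..T}" "\<lambda>s. cis (a * y s)"]
    by (simp add: integral_restrict_space set_lebesgue_integral_def)
qed

lemma borel_measurable_cis_path:
  fixes Y :: "real \<Rightarrow> 'a \<Rightarrow> real"
  assumes Y: "\<And>t. Y t \<in> borel_measurable M" and cont: "\<And>\<omega>. continuous_on UNIV (\<lambda>t. Y t \<omega>)"
  shows "(\<lambda>(s, \<omega>). cis (a * Y s \<omega>)) \<in> borel_measurable (restrict_space lborel A \<Otimes>\<^sub>M M)"
proof -
  have "(\<lambda>x. x) \<in> measurable (restrict_space lborel A) borel"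
    by (simp add: measurable_restrict_space1)
  then have "(\<lambda>x. (fst x, snd x)) \<in> measurable (restrict_space lborel A \<Otimes>\<^sub>M M) (borel \<Otimes>\<^sub>M M)"
    by (intro measurable_Pair measurable_compose[OF measurable_fst] measurable_snd)
  moreover have "(\<lambda>(t, \<omega>). Y t \<omega>) \<in> borel_measurable (borel \<Otimes>\<^sub>M M)"
    by (rule borel_measurable_caratheodory) (rule Y cont)+
  ultimately have "(\<lambda>x. case (fst x, snd x) of (t, \<omega>) \<Rightarrow> Y t \<omega>) \<in> borel_measurable (restrict_space lborel A \<Otimes>\<^sub>M M)"
    by (rule measurable_compose)
  then have "(\<lambda>x. Y (fst x) (snd x)) \<in> borel_measurable (restrict_space lborel A \<Otimes>\<^sub>M M)"
    by simp
  then have "(\<lambda>x. cis (a * Y (fst x) (snd x))) \<in> borel_measurable (restrict_space lborel A \<Otimes>\<^sub>M M)"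
    by (rule measurable_compose) (intro borel_measurable_continuous_onI continuous_intros)
  then show ?thesis
    by (simp add: split_beta')
qed

text \<open>The second moment is the double integral of the covariance
  \<open>exp (- b * \<bar>s - r\<bar>)\<close> with \<open>b = a\<^sup>2 / 2\<close>. The inner
  integral is at most \<open>2 / b = 4 / a\<^sup>2\<close>, and the outer one contributes
  \<open>T\<close>.\<close>

lemma second_moment_integral_cis_le:
  fixes Y :: "real \<Rightarrow> 'a \<Rightarrow> real"
  assumes Y [measurable]: "\<And>t. Y t \<in> borel_measurable M"
    and cont: "\<And>\<omega>. continuous_on UNIV (\<lambda>t. Y t \<omega>)"
    and YW: "AE \<omega> in M. \<forall>t\<ge>0. Y t \<omega> = W t \<omega>"
    and a: "a \<noteq> 0" and T: "0 \<le> T"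
  shows "expectation (\<lambda>\<omega>. (norm (integral {0..T} (\<lambda>s. cis (a * Y s \<omega>))))\<^sup>2) \<le> 4 * T / a\<^sup>2"
proof -
  define L where "L = restrict_space lborel {0..T}"
  define b where "b = a\<^sup>2 / 2"
  have L: "finite_measure L" "measure L (space L) = T"
    using T by (auto simp: L_def measure_restrict_space space_restrict_space emeasure_restrict_space intro!: finite_measureI)
  interpret L: finite_measure L by fact
  have meas: "(\<lambda>(s, \<omega>). cis (a * Y s \<omega>)) \<in> borel_measurable (L \<Otimes>\<^sub>M M)"
    unfolding L_def using Y cont by (rule borel_measurable_cis_path)
  have cov: "expectation (\<lambda>\<omega>. cis (a * Y s \<omega>) * cnj (cis (a * Y r \<omega>))) = of_real (exp (- b * \<bar>s - r\<bar>))"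
    if "s \<in> space L" "r \<in> space L" for s r
  proof -
    have sr: "0 \<le> s" "0 \<le> r"
      using that by (auto simp: L_def space_restrict_space)
    have "expectation (\<lambda>\<omega>. cis (a * Y s \<omega>) * cnj (cis (a * Y r \<omega>))) = expectation (\<lambda>\<omega>. cis (a * (W s \<omega> - W r \<omega>)))"
    proof (rule integral_cong_AE)
      show "(\<lambda>\<omega>. cis (a * Y s \<omega>) * cnj (cis (a * Y r \<omega>))) \<in> borel_measurable M"
        using integrable_cis[of "\<lambda>\<omega>. a * Y s \<omega>"] integrable_cis[of "\<lambda>\<omega>. - (a * Y r \<omega>)"]
        by (simp add: cis_cnj)
      show "(\<lambda>\<omega>. cis (a * (W s \<omega> - W r \<omega>))) \<in> borel_measurable M"
        using integrable_cis[of "\<lambda>\<omega>. a * (W s \<omega> - W r \<omega>)"] random_variable sr by simp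
      show "AE \<omega> in M. cis (a * Y s \<omega>) * cnj (cis (a * Y r \<omega>)) = cis (a * (W s \<omega> - W r \<omega>))"
        using YW by eventually_elim (use sr in \<open>simp add: cis_cnj cis_mult right_diff_distrib\<close>)
    qed
    then show ?thesis
      using expectation_cis_increment[of r s a] sr by (simp add: b_def)
  qed
  have "complex_of_real (expectation (\<lambda>\<omega>. (norm (LINT s|L. cis (a * Y s \<omega>)))\<^sup>2))
      = (LINT s|L. LINT r|L. expectation (\<lambda>\<omega>. cis (a * Y s \<omega>) * cnj (cis (a * Y r \<omega>))))"
    using L(1) meas by (intro integral_norm_square_integral) (auto intro: finite_measure_axioms)
  also have "\<dots> = (LINT s|L. LINT r|L. complex_of_real (exp (- b * \<bar>s - r\<bar>)))"
    by (intro Bochner_Integration.integral_cong refl) (rule cov)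
  also have "\<dots> = complex_of_real (LINT s|L. LINT r|L. exp (- b * \<bar>s - r\<bar>))"
    by simp
  finally have "expectation (\<lambda>\<omega>. (norm (LINT s|L. cis (a * Y s \<omega>)))\<^sup>2) = (LINT s|L. LINT r|L. exp (- b * \<bar>s - r\<bar>))"
    by (simp only: of_real_eq_iff)
  also have "\<dots> \<le> (LINT s|L. 2 / b)"
  proof (rule integral_mono')
    show "(LINT r|L. exp (- b * \<bar>s - r\<bar>)) \<le> 2 / b" if "s \<in> space L" for s
      unfolding L_def using that a by (intro integral_exp_neg_abs_le) (auto simp: b_def L_def space_restrict_space)
  qed (use a in \<open>auto simp: b_def\<close>)
  also have "\<dots> = 4 * T / a\<^sup>2"
    using L(2) by (simp add: b_def)
  finally show ?thesis
    by (simp add: integral_cis_eq_lebesgue[OF cont] L_def)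
qed

text \<open>At \<open>T = k\<^sup>2\<close> the squared mean has expectation at most
  \<open>4 / (a\<^sup>2 * k\<^sup>2)\<close>, which is summable in \<open>k\<close>. The sum of the
  squared means is therefore almost surely finite, its terms tend to 0, and interpolation between
  squares gives all real \<open>T\<close>.\<close>

lemma AE_time_mean_cis_tendsto_0:
  assumes a: "a \<noteq> 0"
  shows "AE \<omega> in M. ((\<lambda>T. integral {0..T} (\<lambda>s. cis (a * W s \<omega>)) /\<^sub>R T) \<longlongrightarrow> 0) at_top"
proof -
  obtain Y :: "real \<Rightarrow> 'a \<Rightarrow> real" where Y: "\<And>t. Y t \<in> borel_measurable M" "\<And>\<omega>. continuous_on UNIV (\<lambda>t. Y t \<omega>)"
    and YW: "AE \<omega> in M. continuous_on {0..} (\<lambda>t. W t \<omega>) \<and> (\<forall>t\<ge>0. Y t \<omega> = W t \<omega>)"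
    using exists_continuous_version by blast
  define F where "F k \<omega> = integral {0..(real k)\<^sup>2} (\<lambda>s. cis (a * Y s \<omega>))" for k \<omega>
  define q where "q k \<omega> = (norm (F k \<omega> /\<^sub>R (real k)\<^sup>2))\<^sup>2" for k \<omega>
  have F_meas [measurable]: "F k \<in> borel_measurable M" for k
  proof -
    interpret L: sigma_finite_measure "restrict_space lborel {0..(real k)\<^sup>2}"
      by (intro sigma_finite_measure_restrict_space sigma_finite_lborel) simp
    show ?thesis
      unfolding F_def integral_cis_eq_lebesgue[OF Y(2)]
      using measurable_pair_swap[OF borel_measurable_cis_path[OF Y]]
      by (intro L.borel_measurable_lebesgue_integral) simp
  qed
  have F_bound: "norm (F k \<omega>) \<le> (real k)\<^sup>2" for k \<omega>
    unfolding F_def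
    by (intro order_trans[OF integral_bound[where B = 1]] continuous_intros continuous_on_subset[OF Y(2)]) auto
  have q_mean: "expectation (q k) \<le> 4 / a\<^sup>2 * inverse (real k ^ 2)" for k
  proof -
    have "q k \<omega> = (norm (F k \<omega>))\<^sup>2 * inverse (real k ^ 4)" for \<omega>
      by (simp add: q_def power_mult_distrib power2_eq_square power4_eq_xxxx)
    then have "q k = (\<lambda>\<omega>. (norm (F k \<omega>))\<^sup>2 * inverse (real k ^ 4))"
      by (rule ext)
    then have "expectation (q k) = expectation (\<lambda>\<omega>. (norm (F k \<omega>))\<^sup>2) * inverse (real k ^ 4)"
      by simp
    also have "\<dots> \<le> 4 * (real k)\<^sup>2 / a\<^sup>2 * inverse (real k ^ 4)"
      unfolding F_def using YW by (intro mult_right_mono second_moment_integral_cis_le Y a) auto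
    also have "\<dots> \<le> 4 / a\<^sup>2 * inverse (real k ^ 2)"
      by (cases "k = 0") (auto simp: field_simps power2_eq_square power4_eq_xxxx)
    finally show ?thesis .
  qed
  \<comment> \<open>Working with \<open>ennreal\<close> allows the sum and the expectation to be
    exchanged before finiteness is known.\<close>
  have "(\<integral>\<^sup>+ \<omega>. (\<Sum>k. ennreal (q k \<omega>)) \<partial>M) = (\<Sum>k. \<integral>\<^sup>+ \<omega>. ennreal (q k \<omega>) \<partial>M)"
    unfolding q_def by (rule nn_integral_suminf) measurable
  also have "\<dots> = (\<Sum>k. ennreal (expectation (q k)))"
  proof -
    have q_int: "integrable M (q k)" for k
    proof (rule integrable_const_bound)
      have "norm (F k \<omega> /\<^sub>R (real k)\<^sup>2) \<le> 1" for \<omega>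
        using F_bound[of k \<omega>] by (cases "k = 0") (auto simp: field_simps)
      then have "0 \<le> q k \<omega>" "q k \<omega> \<le> 1" for \<omega>
        unfolding q_def by (intro zero_le_power2 power_le_one norm_ge_zero)+
      then show "AE \<omega> in M. norm (q k \<omega>) \<le> 1"
        by simp
    qed (unfold q_def, measurable)
    then show ?thesis
      by (intro suminf_cong nn_integral_eq_integral q_int) (auto simp: q_def)
  qed
  also have "\<dots> \<le> (\<Sum>k. ennreal (4 / a\<^sup>2 * inverse (real k ^ 2)))"
    by (intro suminf_le ennreal_leI q_mean) auto
  also have "\<dots> < \<top>"
    using inverse_power_summable[of 2, where 'a = real]
    by (subst suminf_ennreal2) (auto intro: summable_mult)
  finally have "AE \<omega> in M. (\<Sum>k. ennreal (q k \<omega>)) \<noteq> \<infinity>"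
    by (intro nn_integral_PInf_AE) (auto simp: q_def)
  with YW show ?thesis
  proof eventually_elim
    case (elim \<omega>)
    have "summable (\<lambda>k. q k \<omega>)"
      using elim(2) by (intro summable_suminf_not_top) (auto simp: q_def)
    then have "(\<lambda>k. norm (F k \<omega> /\<^sub>R (real k)\<^sup>2) ^ 2) \<longlonglongrightarrow> 0"
      unfolding q_def by (rule summable_LIMSEQ_zero)
    then have "(\<lambda>k. norm (F k \<omega> /\<^sub>R (real k)\<^sup>2)) \<longlonglongrightarrow> 0"
      using tendsto_null_power[of "\<lambda>k. norm (F k \<omega> /\<^sub>R (real k)\<^sup>2)"] by simp
    then have "(\<lambda>k. F k \<omega> /\<^sub>R (real k)\<^sup>2) \<longlonglongrightarrow> 0"
      by (rule tendsto_norm_zero_cancel)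
    then have "((\<lambda>T. integral {0..T} (\<lambda>s. cis (a * Y s \<omega>)) /\<^sub>R T) \<longlongrightarrow> 0) at_top"
      unfolding F_def
      by (intro tendsto_mean_of_squares integrable_continuous_interval continuous_intros continuous_on_subset[OF Y(2)]) auto
    \<comment> \<open>On the almost sure event, \<open>Y\<close> and \<open>W\<close> agree at all
      nonnegative times simultaneously, so the conclusion transfers to \<open>W\<close>.\<close>
    moreover have "integral {0..T} (\<lambda>s. cis (a * Y s \<omega>)) = integral {0..T} (\<lambda>s. cis (a * W s \<omega>))" for T
      using elim(1) by (intro Henstock_Kurzweil_Integration.integral_cong) auto
    ultimately show ?case
      by simp
  qed
qed

end

section \<open>Almost sure convergence of the Loewner chains\<close>

theorem proposition1p1:
  fixes M :: "'a measure" and W :: "real \<Rightarrow> 'a \<Rightarrow> real"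
  assumes "standard_brownian_motion M W"
  shows "AE \<omega> in M.
    uniform_caratheodory_limit
      (\<lambda>\<kappa>::real. radial_loewner_chain (\<lambda>t. exp (\<i> * complex_of_real (W (\<kappa> * t) \<omega>))))
      (\<lambda>t z. complex_of_real (exp (- t)) * z) at_top"
proof -
  interpret standard_brownian_motion M W by fact
  \<comment> \<open>Countably many frequencies \<open>n\<close> share one null set. It does not
    depend on \<open>\<kappa>\<close>, since all driving functions are rescalings of the same path,
    so the limit can be taken along all real \<open>\<kappa>\<close>.\<close>
  have "AE \<omega> in M. \<forall>n. 1 \<le> n \<longrightarrow>
      ((\<lambda>T. integral {0..T} (\<lambda>s. cis (- real n * W s \<omega>)) /\<^sub>R T) \<longlongrightarrow> 0) at_top"
    unfolding AE_all_countable
  proof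
    show "AE \<omega> in M. 1 \<le> n \<longrightarrow>
        ((\<lambda>T. integral {0..T} (\<lambda>s. cis (- real n * W s \<omega>)) /\<^sub>R T) \<longlongrightarrow> 0) at_top" for n
      using AE_time_mean_cis_tendsto_0[of "- real n"] by (cases "n = 0") simp_all
  qed
  with continuous_paths show ?thesis
  proof eventually_elim
    case (elim \<omega>)
    have cont: "continuous_on A (\<lambda>t. W (\<kappa> * t) \<omega>)" if "0 \<le> \<kappa>" "A \<subseteq> {0..}" for \<kappa> A
      by (rule continuous_on_compose2[OF elim(1)]) (use that in \<open>auto intro!: continuous_intros\<close>)
    show ?case
    proof (rule uniform_caratheodory_limit_radial_loewner_chain)
      \<comment> \<open>For \<open>\<kappa> \<ge> 0\<close> the path is evaluated only at
        nonnegative times, where it is continuous.\<close>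
      show "\<forall>\<^sub>F \<kappa> in at_top. continuous_on {0..1} (\<lambda>t. exp (\<i> * complex_of_real (W (\<kappa> * t) \<omega>)))"
        using eventually_ge_at_top[of 0]
        by eventually_elim (intro continuous_intros cont, auto)
      fix n :: nat assume n: "1 \<le> n"
      \<comment> \<open>The inverse powers of the driving function are the Fourier modes of
        frequency \<open>- n\<close> along the path, which the time means control.\<close>
      have "inverse (exp (\<i> * complex_of_real x)) ^ n = cis (- real n * x)" for x
        using Complex.DeMoivre[of "- x" n] by (simp add: cis_inverse flip: cis_conv_exp)
      moreover have "uniform_limit {0..1} (\<lambda>\<kappa> s. integral {0..s} (\<lambda>u. cis (- real n * W (\<kappa> * u) \<omega>))) (\<lambda>_. 0) at_top"
      proof (rule uniform_limit_integral_rescaled)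
        show "continuous_on {0..} (\<lambda>s. cis (- real n * W s \<omega>))"
          by (intro continuous_intros elim(1))
      qed (use elim(2) n in auto)
      ultimately show "uniform_limit {0..1}
          (\<lambda>\<kappa> s. integral {0..s} (\<lambda>u. inverse (exp (\<i> * complex_of_real (W (\<kappa> * u) \<omega>))) ^ n)) (\<lambda>_. 0) at_top"
        by simp
    qed simp
  qed
qed

end
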